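(* Let $m\ge 0$ and let $\Omega_m=\{(\alpha_{\mathbf k},\beta_{\mathbf k}):|\mathbf k|\le m\}$ be a family of pairs of positive numbers satisfying the commutativity condition $\beta_{\mathbf k+\varepsilon_1}\alpha_{\mathbf k}=\alpha_{\mathbf k+\varepsilon_2}\beta_{\mathbf k}$ for all $\mathbf k\in\mathbb Z_+^2$ with $|\mathbf k+\varepsilon_i|\le m$ ($i=1,2$). Let $\tilde m:=2\left[\frac m2\right]+1$ (so $\tilde m=m$ if $m$ is odd and $\tilde m=m+1$ if $m$ is even). Let $\Omega_{\tilde m}$ be $\Omega_m$ itself if $m$ is odd, and a given commutative extension of $\Omega_m$ if $m$ is even. Assume that $M(\Omega_{\tilde m})\ge 0$, and that $\Omega_{\tilde m}$ admits a commutative extension $\hat\Omega_{\tilde m+2}$ such that the moment matrix $M(\hat\Omega_{\tilde m+2})$ is a flat extension of $M(\Omega_{\tilde m})$ (that is, $\operatorname{rank} M(\hat\Omega_{\tilde m+2})=\operatorname{rank} M(\Omega_{\tilde m})$), with $M_x(\hat\Omega_{\tilde m+2})\ge 0$ and $M_y(\hat\Omega_{\tilde m+2})\ge 0$. Then there exists a representing measure $\mu$ for the moments of $\hat\Omega_{\tilde m+2}$ that is supported in $\mathbb R_+^2$ and has exactly $\operatorname{rank} M(\Omega_{\tilde m})$ atoms (and is purely atomic), with precisely $\operatorname{rank} M(\Omega_{\tilde m})-\operatorname{rank} M_x(\hat\Omega_{\tilde m+2})$ atoms in $\{0\}\times\mathbb R_+$ and precisely $\operatorname{rank} M(\Omega_{\tilde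 m})-\operatorname{rank} M_y(\hat\Omega_{\tilde m+2})$ atoms in $\mathbb R_+\times\{0\}$. Moreover, the measure $\mu$ is the Berger measure of a subnormal completion of $\Omega_m$, provided at least one atom of $\mu$ lies in the open positive quadrant $(0,+\infty)^2$.
   Context: Notation: $\mathbb Z_+=\{0,1,2,\dots\}$, $\mathbb R_+=[0,+\infty)$, $\varepsilon_1=(1,0)$, $\varepsilon_2=(0,1)$, $|\mathbf k|=k_1+k_2$ for $\mathbf k=(k_1,k_2)\in\mathbb Z_+^2$, $[\cdot]$ is the integer part. For matrices, $\ge 0$ means positive semi-definite. Weight families: a family $\Omega_m=\{(\alpha_{\mathbf k},\beta_{\mathbf k})\}_{|\mathbf k|\le m}$ of pairs of positive numbers is commutative if $\beta_{\mathbf k+\varepsilon_1}\alpha_{\mathbf k}=\alpha_{\mathbf k+\varepsilon_2}\beta_{\mathbf k}$ whenever $|\mathbf k+\varepsilon_i|\le m$ ($i=1,2$). For $m'\ge m$, a family $\hat\Omega_{m'}=\{(\hat\alpha_{\mathbf k},\hat\beta_{\mathbf k})\}_{|\mathbf k|\le m'}$ of pairs of positive numbers is an extension of $\Omega_m$ if $(\hat\alpha_{\mathbf k},\hat\beta_{\mathbf k})=(\alpha_{\mathbf k},\beta_{\mathbf k})$ for $|\mathbf k|\le m$. Moments: for a commutative family $\Omega_m$ and $i,j\ge0$ with $i+j\le m+1$, the moment $\gamma_{ij}$ is the product of the squares of the weights along any nondecreasing lattice path from $(0,0)$ to $(j,i)$ (a horizontal step from $\mathbf k$ to $\mathbf k+\varepsilon_1$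 contributes $\alpha_{\mathbf k}^2$, a vertical step from $\mathbf k$ to $\mathbf k+\varepsilon_2$ contributes $\beta_{\mathbf k}^2$); $\gamma_{00}=1$. By commutativity this is independent of the path. Thus the first index $i$ of $\gamma_{ij}$ is the exponent of $y$ and the second index $j$ is the exponent of $x$. A representing measure for these moments is a positive Borel measure $\mu$ on $\mathbb R^2$ with $\int y^i x^j\,d\mu(x,y)=\gamma_{ij}$ for all $i+j\le m+1$. Moment and localizing matrices: for $m=2\ell-1$ odd ($\ell\ge1$), $M(\Omega_m):=(\gamma_{\mathbf u+\mathbf v})_{|\mathbf u|,|\mathbf v|\le \ell}$, $M_x(\Omega_m):=(\gamma_{\mathbf u+\mathbf v+(0,1)})_{|\mathbf u|,|\mathbf v|\le \ell-1}$ and $M_y(\Omega_m):=(\gamma_{\mathbf u+\mathbf v+(1,0)})_{|\mathbf u|,|\mathbf v|\le \ell-1}$, with $\mathbf u,\mathbf v\in\mathbb Z_+^2$. 2-variable weighted shifts: for bounded positive double sequences $\alpha_{\mathbf k},\beta_{\mathbf k}$ ($\mathbf k\in\mathbb Z_+^2$), the 2-variable weighted shift $\mathbf T=(T_1,T_2)$ on $\ell^2(\mathbb Z_+^2)$ (canonical orthonormal basis $\{e_{\mathbf k}\}$) is $T_1e_{\mathbf k}=\alpha_{\mathbf k}e_{\mathbf k+\varepsilon_1}$, $T_2e_{\mathbf k}=\beta_{\mathbf k}e_{\mathbf k+\varepsilon_2}$. It is subnormal if it is the restriction of a commuting pair of normal operators to a common invariant subspace; such a shift is commuting (the commutativity condition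 holds for all $\mathbf k$). Its Berger measure is the probability measure $\mu$ on the rectangle $[0,\|T_1\|^2]\times[0,\|T_2\|^2]$ with $\int y^ix^j\,d\mu(x,y)=\gamma_{ij}$ for all $i,j\ge0$, where $\gamma_{00}=1$ and $\gamma_{ij}$ is the product of the squares of the weights of $\mathbf T$ along any nondecreasing lattice path from $(0,0)$ to $(j,i)$ (a horizontal step from $\mathbf k$ to $\mathbf k+\varepsilon_1$ contributes $\alpha_{\mathbf k}^2$, a vertical step from $\mathbf k$ to $\mathbf k+\varepsilon_2$ contributes $\beta_{\mathbf k}^2$). A subnormal completion of $\Omega_m$ is a subnormal 2-variable weighted shift whose weights agree with $(\alpha_{\mathbf k},\beta_{\mathbf k})$ for $|\mathbf k|\le m$. *)

theory Defs
  imports "HOL-Probability.Probability_Measure" "Jordan_Normal_Form.DL_Rank"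
begin

section \<open>Weight families\<close>

text \<open>
  A family \<open>\<Omega>\<^sub>m\<close> is a total function of which only the values at \<open>k\<close> with \<open>deg k \<le> m\<close> are
  meaningful; the same type also serves for the full double sequences of weights of a shift.
  The index \<open>k = (k\<^sub>1, k\<^sub>2)\<close> is a lattice point, with \<open>k\<^sub>1\<close> the horizontal coordinate.
\<close>

type_synonym weight_family = "nat \<times> nat \<Rightarrow> real \<times> real"

definition alpha :: "weight_family \<Rightarrow> nat \<times> nat \<Rightarrow> real" where
  "alpha \<Omega> k = fst (\<Omega> k)"

definition beta :: "weight_family \<Rightarrow> nat \<times> nat \<Rightarrow> real" where
  "beta \<Omega> k = snd (\<Omega> k)"

definition deg :: "nat \<times> nat \<Rightarrow> nat" where
  "deg k = fst k + snd k"

definition positive_family :: "nat \<Rightarrow> weight_family \<Rightarrow> bool" where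
  "positive_family m \<Omega> \<longleftrightarrow> (\<forall>k. deg k \<le> m \<longrightarrow> alpha \<Omega> k > 0 \<and> beta \<Omega> k > 0)"

definition commutative_family :: "nat \<Rightarrow> weight_family \<Rightarrow> bool" where
  "commutative_family m \<Omega> \<longleftrightarrow> positive_family m \<Omega> \<and>
     (\<forall>k. deg (k + (1,0)) \<le> m \<and> deg (k + (0,1)) \<le> m \<longrightarrow>
        beta \<Omega> (k + (1,0)) * alpha \<Omega> k = alpha \<Omega> (k + (0,1)) * beta \<Omega> k)"

definition is_extension :: "nat \<Rightarrow> weight_family \<Rightarrow> nat \<Rightarrow> weight_family \<Rightarrow> bool" where
  "is_extension m' \<Omega>' m \<Omega> \<longleftrightarrow> m \<le> m' \<and> positive_family m' \<Omega>' \<and>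
     (\<forall>k. deg k \<le> m \<longrightarrow> \<Omega>' k = \<Omega> k)"


section \<open>Moments\<close>

datatype lattice_step = Horizontal | Vertical

fun path_product :: "weight_family \<Rightarrow> nat \<times> nat \<Rightarrow> lattice_step list \<Rightarrow> real" where
  "path_product \<Omega> k [] = 1"
| "path_product \<Omega> k (Horizontal # s) = (alpha \<Omega> k)\<^sup>2 * path_product \<Omega> (k + (1,0)) s"
| "path_product \<Omega> k (Vertical # s) = (beta \<Omega> k)\<^sup>2 * path_product \<Omega> (k + (0,1)) s"

text \<open>
  The moment \<open>\<gamma>\<^sub>i\<^sub>j\<close> belongs to the lattice point \<open>(j, i)\<close>: the first index is the exponent of \<open>y\<close>,
  the second the exponent of \<open>x\<close>. It is computed along one particular path; by
  \<open>path_product_eq_moment\<close> below every other path gives the same value.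
\<close>

definition moment :: "weight_family \<Rightarrow> nat \<Rightarrow> nat \<Rightarrow> real" where
  "moment \<Omega> i j = path_product \<Omega> (0,0) (replicate j Horizontal @ replicate i Vertical)"

lemma path_product_swap:
  assumes "commutative_family m \<Omega>" "deg k + 1 + p + q \<le> m + 1"
  shows "path_product \<Omega> k (Vertical # replicate p Horizontal @ replicate q Vertical) =
         path_product \<Omega> k (replicate p Horizontal @ Vertical # replicate q Vertical)"
  using assms(2)
proof (induction p arbitrary: k)
  case 0
  then show ?case by simp
next
  case (Suc p)
  let ?s = "replicate p Horizontal @ replicate q Vertical"
  have comm: "beta \<Omega> (k + (1,0)) * alpha \<Omega> k = alpha \<Omega> (k + (0,1)) * beta \<Omega> k"
    using assms(1) Suc.prems by (cases k) (auto simp: commutative_family_def deg_def)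
  have IH: "path_product \<Omega> (k + (1,0)) (Vertical # ?s) =
      path_product \<Omega> (k + (1,0)) (replicate p Horizontal @ Vertical # replicate q Vertical)"
    by (rule Suc.IH) (use Suc.prems in \<open>auto simp: deg_def\<close>)
  have shift: "k + (0,1) + (1,0) = k + (1,0) + (0,1)"
    by (cases k) simp
  have "path_product \<Omega> k (Vertical # replicate (Suc p) Horizontal @ replicate q Vertical) =
      (alpha \<Omega> (k + (0,1)) * beta \<Omega> k)\<^sup>2 * path_product \<Omega> (k + (0,1) + (1,0)) ?s"
    by (simp add: power_mult_distrib mult_ac)
  also have "\<dots> = (alpha \<Omega> k)\<^sup>2 * path_product \<Omega> (k + (1,0)) (Vertical # ?s)"
    unfolding comm[symmetric] shift by (simp add: power_mult_distrib mult_ac)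
  also have "\<dots> = path_product \<Omega> k
      (replicate (Suc p) Horizontal @ Vertical # replicate q Vertical)"
    unfolding IH by simp
  finally show ?case .
qed

lemma path_product_canonical:
  assumes "commutative_family m \<Omega>" "deg k + length s \<le> m + 1"
  shows "path_product \<Omega> k s =
         path_product \<Omega> k (replicate (count_list s Horizontal) Horizontal @
                           replicate (count_list s Vertical) Vertical)"
  using assms(2)
proof (induction s arbitrary: k)
  case Nil
  then show ?case by simp
next
  case (Cons a s)
  have len: "count_list s Horizontal + count_list s Vertical = length s" for s
    by (induction s) (auto, metis lattice_step.exhaust)
  show ?case
  proof (cases a)
    case Horizontal
    then show ?thesis using Cons.IH[of "k + (1,0)"] Cons.prems by (simp add: deg_def)
  next
    case Vertical
    have "path_product \<Omega> k (a # s) = path_product \<Omega> k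
        (Vertical # replicate (count_list s Horizontal) Horizontal @
                    replicate (count_list s Vertical) Vertical)"
      using Cons.IH[of "k + (0,1)"] Cons.prems Vertical by (simp add: deg_def)
    also have "\<dots> = path_product \<Omega> k
        (replicate (count_list s Horizontal) Horizontal @
         Vertical # replicate (count_list s Vertical) Vertical)"
      by (rule path_product_swap[OF assms(1)]) (use Cons.prems len[of s] in simp)
    finally show ?thesis using Vertical by simp
  qed
qed

lemma path_product_eq_moment:
  assumes "commutative_family m \<Omega>" "i + j \<le> m + 1"
    and "count_list s Horizontal = j" "count_list s Vertical = i"
  shows "path_product \<Omega> (0,0) s = moment \<Omega> i j"
proof -
  have "count_list s Horizontal + count_list s Vertical = length s"
    by (induction s) (auto, metis lattice_step.exhaust)
  then show ?thesis
    using path_product_canonical[OF assms(1), of "(0,0)" s] assms(2-)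
    by (simp add: moment_def deg_def)
qed


section \<open>Moment and localizing matrices\<close>

text \<open>The multi-indices of degree at most \<open>l\<close>, in the order \<open>1, x, y, x\<^sup>2, yx, y\<^sup>2, \<dots>\<close>.\<close>

definition multi_indices :: "nat \<Rightarrow> (nat \<times> nat) list" where
  "multi_indices l = [(i, d - i). d \<leftarrow> [0..<Suc l], i \<leftarrow> [0..<Suc d]]"

lemma set_multi_indices: "set (multi_indices l) = {u. deg u \<le> l}"
proof -
  have "(a, b) \<in> set (multi_indices l)" if "a + b \<le> l" for a b
    using that unfolding multi_indices_def
    by (auto simp del: upt_Suc intro!: bexI[of _ "a + b"] image_eqI[of _ _ a])
  then show ?thesis
    by (auto simp: multi_indices_def deg_def simp del: upt_Suc)
qed

lemma distinct_multi_indices: "distinct (multi_indices l)"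
proof (induction l)
  case 0
  then show ?case by (simp add: multi_indices_def)
next
  case (Suc l)
  have "multi_indices (Suc l) = multi_indices l @ map (\<lambda>i. (i, Suc l - i)) [0..<Suc (Suc l)]"
    by (simp add: multi_indices_def del: upt_Suc add: upt_Suc_append[of 0 "Suc l"])
  moreover have "distinct (map (\<lambda>i. (i, Suc l - i)) [0..<Suc (Suc l)])"
    by (auto simp: distinct_map inj_on_def simp del: upt_Suc)
  moreover have "set (multi_indices l) \<inter> set (map (\<lambda>i. (i, Suc l - i)) [0..<Suc (Suc l)]) = {}"
    unfolding set_multi_indices by (auto simp: deg_def)
  ultimately show ?case using Suc.IH by simp
qed

text \<open>The matrix \<open>(\<gamma>\<^bsub>u + v + w\<^esub>)\<close> with rows and columns indexed by \<open>deg u, deg v \<le> l\<close>.\<close>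

definition shifted_moment_mat :: "nat \<Rightarrow> nat \<times> nat \<Rightarrow> weight_family \<Rightarrow> real mat" where
  "shifted_moment_mat l w \<Omega> =
     mat (length (multi_indices l)) (length (multi_indices l))
       (\<lambda>(r, c). case multi_indices l ! r + multi_indices l ! c + w of (i, j) \<Rightarrow> moment \<Omega> i j)"

text \<open>
  The argument \<open>m\<close> is the degree of the family and is meant to be odd: \<open>m = 2 l - 1\<close> with
  \<open>l = (m + 1) div 2\<close>. Adding \<open>(0,1)\<close> to a moment index multiplies the monomial by \<open>x\<close>.
\<close>

definition M_mat :: "nat \<Rightarrow> weight_family \<Rightarrow> real mat" where
  "M_mat m \<Omega> = shifted_moment_mat ((m + 1) div 2) (0,0) \<Omega>"

definition Mx_mat :: "nat \<Rightarrow> weight_family \<Rightarrow> real mat" where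
  "Mx_mat m \<Omega> = shifted_moment_mat ((m + 1) div 2 - 1) (0,1) \<Omega>"

definition My_mat :: "nat \<Rightarrow> weight_family \<Rightarrow> real mat" where
  "My_mat m \<Omega> = shifted_moment_mat ((m + 1) div 2 - 1) (1,0) \<Omega>"

definition mat_rank :: "real mat \<Rightarrow> nat" where
  "mat_rank A = vec_space.rank (dim_row A) A"

definition pos_semidef :: "real mat \<Rightarrow> bool" where
  "pos_semidef A \<longleftrightarrow> square_mat A \<and> transpose_mat A = A \<and>
     (\<forall>v \<in> carrier_vec (dim_row A). 0 \<le> scalar_prod v (mult_mat_vec A v))"


section \<open>Measures on the plane\<close>

definition has_moment :: "(real \<times> real) measure \<Rightarrow> nat \<Rightarrow> nat \<Rightarrow> real \<Rightarrow> bool" where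
  "has_moment \<mu> i j c \<longleftrightarrow> has_bochner_integral \<mu> (\<lambda>(x, y). y ^ i * x ^ j) c"

definition representing_measure ::
    "nat \<Rightarrow> weight_family \<Rightarrow> (real \<times> real) measure \<Rightarrow> bool" where
  "representing_measure m \<Omega> \<mu> \<longleftrightarrow> sets \<mu> = sets borel \<and>
     (\<forall>i j. i + j \<le> m + 1 \<longrightarrow> has_moment \<mu> i j (moment \<Omega> i j))"

definition supported_in :: "(real \<times> real) measure \<Rightarrow> (real \<times> real) set \<Rightarrow> bool" where
  "supported_in \<mu> S \<longleftrightarrow> emeasure \<mu> (space \<mu> - S) = 0"

definition atoms :: "(real \<times> real) measure \<Rightarrow> (real \<times> real) set" where
  "atoms \<mu> = {p. emeasure \<mu> {p} > 0}"


section \<open>Operators on \<open>\<ell>\<^sup>2\<close>\<close>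

definition ell2 :: "('i \<Rightarrow> complex) set" where
  "ell2 = {f. (\<lambda>i. (cmod (f i))\<^sup>2) summable_on UNIV}"

definition ell2_inner :: "('i \<Rightarrow> complex) \<Rightarrow> ('i \<Rightarrow> complex) \<Rightarrow> complex" where
  "ell2_inner f g = (\<Sum>\<^sub>\<infinity>i. f i * cnj (g i))"

definition ell2_norm :: "('i \<Rightarrow> complex) \<Rightarrow> real" where
  "ell2_norm f = sqrt (\<Sum>\<^sub>\<infinity>i. (cmod (f i))\<^sup>2)"

text \<open>Only the values of an operator on \<open>ell2\<close> are relevant.\<close>

definition bounded_operator :: "(('i \<Rightarrow> complex) \<Rightarrow> ('j \<Rightarrow> complex)) \<Rightarrow> bool" where
  "bounded_operator A \<longleftrightarrow>
     (\<forall>f \<in> ell2. A f \<in> ell2) \<and>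
     (\<forall>f \<in> ell2. \<forall>g \<in> ell2. A (\<lambda>i. f i + g i) = (\<lambda>j. A f j + A g j)) \<and>
     (\<forall>c. \<forall>f \<in> ell2. A (\<lambda>i. c * f i) = (\<lambda>j. c * A f j)) \<and>
     (\<exists>C. \<forall>f \<in> ell2. ell2_norm (A f) \<le> C * ell2_norm f)"

definition operator_norm :: "(('i \<Rightarrow> complex) \<Rightarrow> ('j \<Rightarrow> complex)) \<Rightarrow> real" where
  "operator_norm A = (SUP f \<in> {f \<in> ell2. ell2_norm f \<le> 1}. ell2_norm (A f))"

definition linear_isometry :: "(('i \<Rightarrow> complex) \<Rightarrow> ('j \<Rightarrow> complex)) \<Rightarrow> bool" where
  "linear_isometry V \<longleftrightarrow> bounded_operator V \<and> (\<forall>f \<in> ell2. ell2_norm (V f) = ell2_norm f)"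

definition is_adjoint ::
    "(('i \<Rightarrow> complex) \<Rightarrow> ('i \<Rightarrow> complex)) \<Rightarrow> (('i \<Rightarrow> complex) \<Rightarrow> ('i \<Rightarrow> complex)) \<Rightarrow> bool" where
  "is_adjoint A B \<longleftrightarrow> (\<forall>f \<in> ell2. \<forall>g \<in> ell2. ell2_inner (A f) g = ell2_inner f (B g))"

definition operators_commute ::
    "(('i \<Rightarrow> complex) \<Rightarrow> ('i \<Rightarrow> complex)) \<Rightarrow> (('i \<Rightarrow> complex) \<Rightarrow> ('i \<Rightarrow> complex)) \<Rightarrow> bool" where
  "operators_commute A B \<longleftrightarrow> (\<forall>f \<in> ell2. A (B f) = B (A f))"

definition normal_operator :: "(('i \<Rightarrow> complex) \<Rightarrow> ('i \<Rightarrow> complex)) \<Rightarrow> bool" where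
  "normal_operator N \<longleftrightarrow> bounded_operator N \<and>
     (\<exists>N'. bounded_operator N' \<and> is_adjoint N N' \<and> operators_commute N N')"

text \<open>
  The ambient space of the normal extension is \<open>\<ell>\<^sup>2(\<nat>)\<close>, containing the space of the given pair as
  the range of the isometry \<open>V\<close>; the intertwining relations say that this range is invariant
  and that the restrictions are \<open>T\<^sub>1\<close> and \<open>T\<^sub>2\<close>. For a pair on an infinite-dimensional separable
  Hilbert space nothing is lost by fixing the ambient space: the smallest subspace that contains
  it and reduces a given normal extension is again infinite-dimensional and separable, hence
  unitarily equivalent to \<open>\<ell>\<^sup>2(\<nat>)\<close>.
\<close>

definition subnormal_pair ::
    "((nat \<times> nat \<Rightarrow> complex) \<Rightarrow> (nat \<times> nat \<Rightarrow> complex)) \<Rightarrow>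
     ((nat \<times> nat \<Rightarrow> complex) \<Rightarrow> (nat \<times> nat \<Rightarrow> complex)) \<Rightarrow> bool" where
  "subnormal_pair T1 T2 \<longleftrightarrow>
     (\<exists>(N1 :: (nat \<Rightarrow> complex) \<Rightarrow> (nat \<Rightarrow> complex)) N2 V.
        normal_operator N1 \<and> normal_operator N2 \<and> operators_commute N1 N2 \<and>
        linear_isometry V \<and>
        (\<forall>f \<in> ell2. N1 (V f) = V (T1 f)) \<and> (\<forall>f \<in> ell2. N2 (V f) = V (T2 f)))"


section \<open>Two-variable weighted shifts\<close>

definition shift1 :: "weight_family \<Rightarrow> (nat \<times> nat \<Rightarrow> complex) \<Rightarrow> (nat \<times> nat \<Rightarrow> complex)" where
  "shift1 \<Omega> f = (\<lambda>(p, q). if p = 0 then 0 else of_real (alpha \<Omega> (p - 1, q)) * f (p - 1, q))"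

definition shift2 :: "weight_family \<Rightarrow> (nat \<times> nat \<Rightarrow> complex) \<Rightarrow> (nat \<times> nat \<Rightarrow> complex)" where
  "shift2 \<Omega> f = (\<lambda>(p, q). if q = 0 then 0 else of_real (beta \<Omega> (p, q - 1)) * f (p, q - 1))"

definition basis_vec :: "nat \<times> nat \<Rightarrow> nat \<times> nat \<Rightarrow> complex" where
  "basis_vec k = (\<lambda>l. if l = k then 1 else 0)"

lemma shift1_basis_vec:
  "shift1 \<Omega> (basis_vec k) = (\<lambda>l. of_real (alpha \<Omega> k) * basis_vec (k + (1,0)) l)"
  by (cases k) (auto simp: shift1_def basis_vec_def fun_eq_iff)

lemma shift2_basis_vec:
  "shift2 \<Omega> (basis_vec k) = (\<lambda>l. of_real (beta \<Omega> k) * basis_vec (k + (0,1)) l)"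
  by (cases k) (auto simp: shift2_def basis_vec_def fun_eq_iff)

definition shift_weights :: "weight_family \<Rightarrow> bool" where
  "shift_weights \<Omega> \<longleftrightarrow> (\<forall>k. alpha \<Omega> k > 0 \<and> beta \<Omega> k > 0) \<and>
     (\<exists>C. \<forall>k. alpha \<Omega> k \<le> C \<and> beta \<Omega> k \<le> C)"

definition subnormal_completion :: "nat \<Rightarrow> weight_family \<Rightarrow> weight_family \<Rightarrow> bool" where
  "subnormal_completion m \<Omega> W \<longleftrightarrow> shift_weights W \<and>
     subnormal_pair (shift1 W) (shift2 W) \<and> (\<forall>k. deg k \<le> m \<longrightarrow> W k = \<Omega> k)"

definition berger_measure :: "weight_family \<Rightarrow> (real \<times> real) measure \<Rightarrow> bool" where
  "berger_measure W \<mu> \<longleftrightarrow> prob_space \<mu> \<and> sets \<mu> = sets borel \<and>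
     supported_in \<mu> ({0..(operator_norm (shift1 W))\<^sup>2} \<times> {0..(operator_norm (shift2 W))\<^sup>2}) \<and>
     (\<forall>i j. has_moment \<mu> i j (moment W i j))"

end

theory Submission
  imports Defs "HOL-Library.Function_Algebras"
    "HOL-Computational_Algebra.Fundamental_Theorem_Algebra"
begin

text \<open>
  Write \<open>\<gamma>\<close> for the moments of the extended family, indexed by lattice points, and let \<open>l\<close> be the
  degree that indexes the rows of the given moment matrix, so that the flat extension has rows of
  degree at most \<open>l + 1\<close>. Positivity makes \<open>(p, q) \<mapsto> L(p q)\<close>, with \<open>L\<close> the functional
  \<open>x\<^sup>j y\<^sup>i \<mapsto> \<gamma>\<^sub>i\<^sub>j\<close>, an inner product on polynomials of degree at most \<open>l\<close> modulo its kernel.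
  Flatness says that every polynomial of degree \<open>l + 1\<close> agrees, modulo the kernel of the larger
  form, with one of degree \<open>l\<close>. Multiplication by \<open>x\<close> and by \<open>y\<close> therefore induces linear maps of
  this finite-dimensional space to itself. They are symmetric, since \<open>L(x p \<cdot> q) = L(p \<cdot> x q)\<close>, and
  they commute. An orthonormal basis of common eigenvectors turns the constant polynomial
  into a vector whose squared coordinates are the masses, while the pairs of eigenvalues are the
  atoms; Parseval's identity is the quadrature formula. The constant is a cyclic vector, so no
  mass vanishes and no two eigenvectors share a pair of eigenvalues: the number of atoms is the
  dimension, which is the rank.

  To avoid quotients, the space is realised as the coefficient vectors supported on a set \<open>J\<close> of
  monomials whose columns form a basis of the column space (locale \<open>flat_frame\<close>, theorem
  \<open>atomic_representation\<close>); \<open>common_eigenbasis\<close> is the diagonalization. Once the atoms are known, the localizing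
  matrices are diagonal in the evaluation vectors of the atoms, with diagonal entries mass times
  coordinate. This gives both the nonnegativity of the coordinates and the ranks
  (\<open>dim_columns_biorthogonal\<close>, \<open>flat_moments_atomic\<close>).

  If an atom lies in the open quadrant, all moments of the measure are positive, so
  the square roots of their successive quotients are weights, and they extend the given ones.
  Over the \<open>s\<close>-th atom \<open>(x, y)\<close> one places a copy of \<open>\<ell>\<^sup>2(\<int>\<^sup>2)\<close> on which the two bilateral shifts, scaled
  by \<open>\<surd>x\<close> and \<open>\<surd>y\<close>, act as commuting normal operators. Sending the basis vector at \<open>k\<close> to the
  vector whose component over an atom is the square root of its share of the \<open>k\<close>-th moment is an
  isometry that intertwines the weighted shifts with these operators (\<open>subnormal_W\<close>). The squared
  norm of the first weighted shift dominates the growth rate of the moments along the horizontal axis, which is the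
  largest abscissa of an atom, and symmetrically for the second; this locates the support of the Berger
  measure (\<open>berger_measure_W\<close>).
\<close>

hide_const (open) VectorSpace.subspace Module.module.smult

section \<open>Functions as a real vector space\<close>

text \<open>
  Columns of matrices and coefficient vectors of polynomials have index sets that depend on the
  degree. As functions on all indices they live in one vector space, where spans and
  dimensions for different degrees can be compared.
\<close>

instantiation "fun" :: (type, real_vector) real_vector
begin

definition scaleR_fun :: "real \<Rightarrow> ('a \<Rightarrow> 'b) \<Rightarrow> 'a \<Rightarrow> 'b" where
  "scaleR_fun r f = (\<lambda>x. r *\<^sub>R f x)"

instance
  by standard (auto simp: scaleR_fun_def fun_eq_iff scaleR_add_right scaleR_add_left)

end

lemma scaleR_fun_apply [simp]: "(r *\<^sub>R f) x = r *\<^sub>R f x"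
  by (simp add: scaleR_fun_def)

lemma sum_fun_apply [simp]: "(\<Sum>i\<in>A. f i) x = (\<Sum>i\<in>A. f i x)"
  by (induction A rule: infinite_finite_induct) auto

section \<open>Matrices with rows and columns indexed by a list\<close>

lemma sum_nth_distinct:
  assumes "distinct xs"
  shows "(\<Sum>r<length xs. f (xs ! r)) = sum f (set xs)"
  by (rule sum.reindex_bij_betw) (rule bij_betw_nth[OF assms], simp_all)

lemma pos_semidef_kernel:
  fixes K :: "'i \<Rightarrow> 'i \<Rightarrow> real"
  assumes "distinct xs"
    and "pos_semidef (mat (length xs) (length xs) (\<lambda>(r, c). K (xs ! r) (xs ! c)))"
  shows "0 \<le> (\<Sum>u\<in>set xs. \<Sum>v\<in>set xs. c u * c v * K u v)"
proof -
  let ?n = "length xs"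
  let ?A = "mat ?n ?n (\<lambda>(r, c). K (xs ! r) (xs ! c))"
  let ?v = "vec ?n (\<lambda>r. c (xs ! r))"
  have "0 \<le> scalar_prod ?v (mult_mat_vec ?A ?v)"
    using assms(2) by (auto simp: pos_semidef_def)
  also have "\<dots> = (\<Sum>r<?n. \<Sum>s<?n. c (xs ! r) * c (xs ! s) * K (xs ! r) (xs ! s))"
    by (simp add: scalar_prod_def atLeast0LessThan sum_distrib_left mult_ac)
  also have "\<dots> = (\<Sum>r<?n. \<Sum>v\<in>set xs. c (xs ! r) * c v * K (xs ! r) v)"
    by (rule sum.cong[OF refl]) (rule sum_nth_distinct[OF assms(1)])
  also have "\<dots> = (\<Sum>u\<in>set xs. \<Sum>v\<in>set xs. c u * c v * K u v)"
    by (rule sum_nth_distinct[OF assms(1)])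
  finally show ?thesis .
qed

text \<open>
  The vector with its coordinates relabelled by the entries of the list and extended by zero.
  The map is injective on vectors of the right dimension, so it preserves linear independence.
\<close>

definition vec_fun :: "'i list \<Rightarrow> real vec \<Rightarrow> 'i \<Rightarrow> real" where
  "vec_fun xs v = (\<lambda>u. \<Sum>r<length xs. if xs ! r = u then v $ r else 0)"

lemma vec_fun_nth:
  assumes "distinct xs" "r < length xs"
  shows "vec_fun xs v (xs ! r) = v $ r"
proof -
  have "vec_fun xs v (xs ! r) = (\<Sum>s<length xs. if s = r then v $ s else 0)"
    unfolding vec_fun_def
    by (rule sum.cong) (use assms in \<open>auto simp: nth_eq_iff_index_eq\<close>)
  then show ?thesis using assms by simp
qed

lemma vec_fun_outside: "u \<notin> set xs \<Longrightarrow> vec_fun xs v u = 0"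
  unfolding vec_fun_def by (rule sum.neutral) auto

text \<open>
  The rank is the size of a maximal independent set \<open>U\<close> of columns. Relabelling coordinates keeps \<open>U\<close>
  independent, and by maximality it spans the relabelled columns.
\<close>

lemma mat_rank_kernel:
  fixes K :: "'i \<Rightarrow> 'i \<Rightarrow> real"
  assumes dist: "distinct xs"
  shows "mat_rank (mat (length xs) (length xs) (\<lambda>(r, c). K (xs ! r) (xs ! c))) =
         dim ((\<lambda>c r. if r \<in> set xs then K r c else 0) ` set xs)"
proof -
  define n where "n = length xs"
  define A where "A = mat n n (\<lambda>(r, c). K (xs ! r) (xs ! c))"
  interpret vs: vec_space "TYPE(real)" n .
  let ?h = "vec_fun xs"
  have A: "A \<in> carrier_mat n n" by (simp add: A_def)
  have cols: "set (cols A) \<subseteq> carrier_vec n" using cols_dim[of A] A by auto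
  have "\<exists>U. finite U \<and> maximal U (\<lambda>T. T \<subseteq> set (cols A) \<and> \<not> vs.lin_dep T) \<and> {} \<subseteq> U"
    by (rule maximal_exists_superset[of "set (cols A)"]) (auto simp: vs.lin_dep_def)
  then obtain U where U: "finite U"
    and max: "maximal U (\<lambda>T. T \<subseteq> set (cols A) \<and> \<not> vs.lin_dep T)" by auto
  from max have Usub: "U \<subseteq> set (cols A)" and Uind: "\<not> vs.lin_dep U"
    and Umax: "\<And>T. U \<subseteq> T \<Longrightarrow> T \<subseteq> set (cols A) \<Longrightarrow> \<not> vs.lin_dep T \<Longrightarrow> T = U"
    by (auto simp: maximal_def)
  have Ucarr: "U \<subseteq> carrier_vec n" using Usub cols by blast
  have rank: "vs.rank A = card U" by (rule vs.rank_card_indpt[OF A max])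
  have lincomb: "?h (vs.lincomb a T) = (\<Sum>v\<in>T. a v *\<^sub>R ?h v)" if "T \<subseteq> U" for a T
  proof
    fix u
    have T: "T \<subseteq> carrier_vec n" using that Ucarr by blast
    show "?h (vs.lincomb a T) u = (\<Sum>v\<in>T. a v *\<^sub>R ?h v) u"
    proof (cases "u \<in> set xs")
      case True
      then obtain r where r: "r < length xs" "u = xs ! r" by (auto simp: in_set_conv_nth)
      then show ?thesis
        using T vs.lincomb_index[of r T a] by (simp add: vec_fun_nth[OF dist] n_def)
    qed (simp add: vec_fun_outside)
  qed
  have inj: "inj_on ?h (carrier_vec n)"
  proof (rule inj_onI)
    fix v w assume vw: "v \<in> carrier_vec n" "w \<in> carrier_vec n" "?h v = ?h w"
    show "v = w"
    proof (rule eq_vecI)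
      fix i assume "i < dim_vec w"
      then show "v $ i = w $ i"
        using vw vec_fun_nth[OF dist, of i v] vec_fun_nth[OF dist, of i w] by (simp add: n_def)
    qed (use vw in simp)
  qed
  have injU: "inj_on ?h U" using inj Ucarr by (rule inj_on_subset)
  have indep: "independent (?h ` U)"
  proof (rule independent_if_scalars_zero)
    fix f x assume sum: "(\<Sum>x\<in>?h ` U. f x *\<^sub>R x) = 0" and x: "x \<in> ?h ` U"
    have "?h (vs.lincomb (f \<circ> ?h) U) = 0"
      using sum by (simp add: lincomb sum.reindex[OF injU])
    moreover have "?h (0\<^sub>v n) = 0"
      by (auto simp: vec_fun_def fun_eq_iff n_def intro!: sum.neutral)
    moreover have "vs.lincomb (f \<circ> ?h) U \<in> carrier_vec n"
      using Ucarr by (rule vs.lincomb_closed)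
    ultimately have "vs.lincomb (f \<circ> ?h) U = 0\<^sub>v n"
      using inj_onD[OF inj, of "vs.lincomb (f \<circ> ?h) U" "0\<^sub>v n"] by simp
    moreover have "a v = 0" if "finite T" "T \<subseteq> U" "vs.lincomb a T = 0\<^sub>v n" "v \<in> T" for T a v
      using Uind that unfolding vs.lin_dep_def by (auto simp: class_ring_simps)
    ultimately have "(f \<circ> ?h) v = 0" if "v \<in> U" for v using U that by blast
    then show "f x = 0" using x by auto
  qed (use U in simp)
  have span: "?h ` set (cols A) \<subseteq> span (?h ` U)"
  proof
    fix y assume "y \<in> ?h ` set (cols A)"
    then obtain c where c: "c \<in> set (cols A)" "y = ?h c" by auto
    show "y \<in> span (?h ` U)"
    proof (cases "c \<in> U")
      case True
      then show ?thesis using c by (auto intro: span_base)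
    next
      case False
      then have "vs.lin_dep (U \<union> {c})" using Umax[of "U \<union> {c}"] Usub c by blast
      then have "c \<in> vs.span U"
        using vs.lin_dep_iff_in_span[of U c] Ucarr Uind False c cols by auto
      then obtain a T where T: "finite T" "T \<subseteq> U" "c = vs.lincomb a T"
        unfolding vs.span_def by auto
      have "y = (\<Sum>v\<in>T. a v *\<^sub>R ?h v)" using c(2) T lincomb by simp
      also have "\<dots> \<in> span (?h ` U)"
        by (intro span_sum span_scale span_base) (use T in auto)
      finally show ?thesis .
    qed
  qed
  have col: "?h (col A c) = (\<lambda>r. if r \<in> set xs then K r (xs ! c) else 0)" if "c < n" for c
  proof
    fix u
    show "?h (col A c) u = (if u \<in> set xs then K u (xs ! c) else 0)"
    proof (cases "u \<in> set xs")
      case True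
      then obtain r where r: "r < length xs" "u = xs ! r" by (auto simp: in_set_conv_nth)
      then show ?thesis using that by (simp add: vec_fun_nth[OF dist] A_def n_def)
    qed (simp add: vec_fun_outside)
  qed
  have "set (cols A) = col A ` {..<n}"
    by (auto simp: cols_def A_def)
  then have "?h ` set (cols A) = (\<lambda>c. ?h (col A c)) ` {..<n}"
    by (simp add: image_image)
  also have "\<dots> = (\<lambda>c r. if r \<in> set xs then K r (xs ! c) else 0) ` {..<n}"
    by (rule image_cong) (simp_all add: col)
  also have "\<dots> = (\<lambda>c r. if r \<in> set xs then K r c else 0) ` set xs"
    by (simp add: set_conv_nth image_def n_def) blast
  finally have image: "?h ` set (cols A) = (\<lambda>c r. if r \<in> set xs then K r c else 0) ` set xs" .
  have "dim (?h ` set (cols A)) = card U"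
    by (rule dim_unique[of "?h ` U"]) (use Usub span indep card_image[OF injU] in auto)
  then show ?thesis using rank unfolding image by (simp add: mat_rank_def A_def n_def)
qed

text \<open>
  Stated for families because the vectors may coincide, in which case the difference of two
  of them is already a nontrivial relation.
\<close>

lemma dependent_family:
  fixes f :: "'i \<Rightarrow> 'a::real_vector"
  assumes "finite B" "finite I" "card B < card I" "\<And>i. i \<in> I \<Longrightarrow> f i \<in> span B"
  shows "\<exists>c. (\<exists>i\<in>I. c i \<noteq> 0) \<and> (\<Sum>i\<in>I. c i *\<^sub>R f i) = 0"
proof (cases "inj_on f I")
  case True
  have "dependent (f ` I)"
  proof (rule ccontr)
    assume "independent (f ` I)"
    then have "card (f ` I) \<le> card B"
      using independent_span_bound[OF assms(1)] assms(4) by blast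
    then show False using assms(3) card_image[OF True] by simp
  qed
  then obtain u where u: "\<exists>v\<in>f ` I. u v \<noteq> 0" "(\<Sum>v\<in>f ` I. u v *\<^sub>R v) = 0"
    using assms(2) by (auto simp: dependent_finite)
  then show ?thesis by (intro exI[of _ "u \<circ> f"]) (auto simp: sum.reindex[OF True])
next
  case False
  then obtain i j where ij: "i \<in> I" "j \<in> I" "i \<noteq> j" "f i = f j" by (auto simp: inj_on_def)
  let ?c = "\<lambda>k. if k = i then 1 else if k = j then -1 else (0::real)"
  have "(\<Sum>k\<in>I. ?c k *\<^sub>R f k) = (\<Sum>k\<in>{i, j}. ?c k *\<^sub>R f k)"
    by (rule sum.mono_neutral_right) (use assms(2) ij in auto)
  also have "\<dots> = 0" using ij by simp
  finally show ?thesis using ij(1) by (intro exI[of _ ?c]) auto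
qed

section \<open>Polynomials in an operator\<close>

definition poly_apply :: "('a \<Rightarrow> 'a::real_vector) \<Rightarrow> real poly \<Rightarrow> 'a \<Rightarrow> 'a" where
  "poly_apply Z p v = (\<Sum>i\<le>degree p. coeff p i *\<^sub>R (Z ^^ i) v)"

lemma poly_apply_bound:
  assumes "degree p \<le> n"
  shows "poly_apply Z p v = (\<Sum>i\<le>n. coeff p i *\<^sub>R (Z ^^ i) v)"
  unfolding poly_apply_def
  by (rule sum.mono_neutral_left) (use assms in \<open>auto intro: coeff_eq_0\<close>)

lemma poly_apply_0 [simp]: "poly_apply Z 0 v = 0"
  by (simp add: poly_apply_def)

lemma poly_apply_add: "poly_apply Z (p + q) v = poly_apply Z p v + poly_apply Z q v"
  by (simp add: poly_apply_bound[of _ "max (degree p) (degree q)"] degree_add_le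
      scaleR_add_left sum.distrib)

lemma poly_apply_smult: "poly_apply Z (smult a p) v = a *\<^sub>R poly_apply Z p v"
  by (simp add: poly_apply_bound[of _ "degree p"] scaleR_sum_right)

lemma poly_apply_pCons:
  assumes "linear Z"
  shows "poly_apply Z (pCons a p) v = a *\<^sub>R v + Z (poly_apply Z p v)"
proof -
  have "poly_apply Z (pCons a p) v = (\<Sum>i\<le>Suc (degree p). coeff (pCons a p) i *\<^sub>R (Z ^^ i) v)"
    by (rule poly_apply_bound) (simp add: degree_pCons_le)
  also have "\<dots> = a *\<^sub>R v + Z (\<Sum>i\<le>degree p. coeff p i *\<^sub>R (Z ^^ i) v)"
    by (subst sum.atMost_Suc_shift) (simp add: linear_sum[OF assms] linear_scale[OF assms])
  finally show ?thesis by (simp add: poly_apply_def)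
qed

lemma poly_apply_mult:
  assumes "linear Z"
  shows "poly_apply Z (p * q) v = poly_apply Z p (poly_apply Z q v)"
  by (induction p)
     (simp_all add: poly_apply_add poly_apply_smult poly_apply_pCons[OF assms])

lemma poly_apply_mem:
  assumes "subspace W" "\<And>w. w \<in> W \<Longrightarrow> Z w \<in> W" "v \<in> W"
  shows "poly_apply Z p v \<in> W"
proof -
  have "(Z ^^ i) v \<in> W" for i by (induction i) (use assms in auto)
  then show ?thesis
    unfolding poly_apply_def using assms(1) by (intro subspace_sum subspace_scale)
qed

section \<open>Simultaneous diagonalization\<close>

text \<open>
  The form is required to be positive definite only on \<open>V\<close>. The set \<open>B\<close> serves to bound the dimension
  of \<open>V\<close>.
\<close>

locale inner_product_on =
  fixes V :: "'a::real_vector set" and ip :: "'a \<Rightarrow> 'a \<Rightarrow> real" and B :: "'a set"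
  assumes subspace_V: "subspace V"
    and finite_B: "finite B" and V_span: "V \<subseteq> span B"
    and ip_bilinear: "bilinear ip"
    and ip_commute: "v \<in> V \<Longrightarrow> w \<in> V \<Longrightarrow> ip v w = ip w v"
    and ip_pos: "v \<in> V \<Longrightarrow> v \<noteq> 0 \<Longrightarrow> 0 < ip v v"
begin

lemmas ip_simps = bilinear_ladd[OF ip_bilinear] bilinear_radd[OF ip_bilinear]
  bilinear_lmul[OF ip_bilinear] bilinear_rmul[OF ip_bilinear]
  bilinear_lsub[OF ip_bilinear] bilinear_rsub[OF ip_bilinear]
  bilinear_lzero[OF ip_bilinear] bilinear_rzero[OF ip_bilinear]

lemma ip_sum_left: "ip (\<Sum>i\<in>A. f i) w = (\<Sum>i\<in>A. ip (f i) w)"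
  using ip_bilinear by (simp add: bilinear_def linear_sum[of "\<lambda>v. ip v w"])

lemma ip_sum_right: "ip v (\<Sum>i\<in>A. f i) = (\<Sum>i\<in>A. ip v (f i))"
  using ip_bilinear by (simp add: bilinear_def linear_sum[of "ip v"])

lemma ip_nonneg: "v \<in> V \<Longrightarrow> 0 \<le> ip v v"
  using ip_pos[of v] by (cases "v = 0") (auto simp: bilinear_lzero[OF ip_bilinear])

text \<open>
  Among all pairs of a nonzero \<open>v\<close> in \<open>W\<close> and a nonzero polynomial \<open>p\<close> with \<open>p(Z) v = 0\<close>, take one
  with \<open>p\<close> of least degree; such pairs exist because the iterates of a vector under \<open>Z\<close> are linearly
  dependent. If \<open>p\<close> has a real root \<open>x\<close>, the cofactor of \<open>t - x\<close> maps \<open>v\<close> to a vector that is nonzero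
  by minimality, hence an eigenvector. A nonreal root \<open>a + i b\<close> would give in the same way a nonzero
  \<open>w\<close> with \<open>((Z - a)\<^sup>2 + b\<^sup>2) w = 0\<close>. Pairing with \<open>w\<close> and using symmetry, the squared norm of
  \<open>(Z - a) w\<close> plus \<open>b\<^sup>2\<close> times that of \<open>w\<close> would vanish, which is impossible.
\<close>

lemma symmetric_eigenvector:
  assumes lin: "linear Z" and W: "subspace W" "W \<subseteq> V" "\<And>w. w \<in> W \<Longrightarrow> Z w \<in> W"
    and sym: "\<And>v w. v \<in> W \<Longrightarrow> w \<in> W \<Longrightarrow> ip (Z v) w = ip v (Z w)"
    and nz: "W \<noteq> {0}"
  shows "\<exists>w\<in>W. w \<noteq> 0 \<and> (\<exists>x. Z w = x *\<^sub>R w)"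
proof -
  \<comment> \<open>\<open>P n\<close> holds when some nonzero polynomial of degree \<open>n\<close> in \<open>Z\<close> annihilates a nonzero vector of \<open>W\<close>.\<close>
  define P where "P n \<longleftrightarrow> (\<exists>p v. v \<in> W \<and> v \<noteq> 0 \<and> p \<noteq> 0 \<and> degree p = n \<and> poly_apply Z p v = 0)" for n
  have "0 \<in> W" using W(1) by (rule subspace_0)
  then obtain v0 where v0: "v0 \<in> W" "v0 \<noteq> 0" using nz by blast
  have "(Z ^^ i) v0 \<in> W" for i by (induction i) (use W v0 in auto)
  then have "\<exists>c. (\<exists>i\<in>{..card B}. c i \<noteq> 0) \<and> (\<Sum>i\<le>card B. c i *\<^sub>R (Z ^^ i) v0) = 0"
    using W(2) V_span by (intro dependent_family[OF finite_B]) auto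
  then obtain c i where c: "i \<le> card B" "c i \<noteq> 0" "(\<Sum>i\<le>card B. c i *\<^sub>R (Z ^^ i) v0) = 0"
    by auto
  define p0 where "p0 = (\<Sum>i\<le>card B. monom (c i) i)"
  have coeff_p0: "coeff p0 j = (if j \<le> card B then c j else 0)" for j
    by (simp add: p0_def coeff_sum if_distrib)
  have "poly_apply Z p0 v0 = (\<Sum>i\<le>card B. c i *\<^sub>R (Z ^^ i) v0)"
    by (subst poly_apply_bound[of _ "card B"]) (auto simp: coeff_p0 intro!: degree_le)
  moreover have "p0 \<noteq> 0" using coeff_p0[of i] c by auto
  ultimately have "P (degree p0)" unfolding P_def using v0 c by auto
  define n where "n = (LEAST n. P n)"
  have "P n" unfolding n_def by (rule LeastI) fact
  then obtain p v where p: "v \<in> W" "v \<noteq> 0" "p \<noteq> 0" "degree p = n" "poly_apply Z p v = 0"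
    unfolding P_def by blast
  have least: "poly_apply Z q w \<noteq> 0" if "w \<in> W" "w \<noteq> 0" "q \<noteq> 0" "degree q < n" for q w
  proof
    assume "poly_apply Z q w = 0"
    then have "P (degree q)" using that unfolding P_def by blast
    then show False using not_less_Least[of "degree q" P] that(4) by (simp add: n_def)
  qed
  have mem: "poly_apply Z q w \<in> W" if "w \<in> W" for q w
    by (rule poly_apply_mem) (use W that in auto)
  have "n \<noteq> 0"
  proof
    assume "n = 0"
    then have "coeff p 0 *\<^sub>R v = 0" "coeff p 0 \<noteq> 0"
      using p(3-5) leading_coeff_neq_0[of p] by (simp_all add: poly_apply_def)
    then show False using p by simp
  qed
  let ?pc = "map_poly complex_of_real p"
  have "degree ?pc = n" using p(4) by (simp add: degree_map_poly)
  then have "\<not> constant (poly ?pc)" using \<open>n \<noteq> 0\<close> by (simp add: constant_degree)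
  then obtain z where z: "poly ?pc z = 0" using fundamental_theorem_of_algebra by blast
  have poly_of_real: "poly (map_poly complex_of_real q) (of_real t) = of_real (poly q t)" for q t
    by (induction q) (simp_all add: map_poly_pCons)
  show ?thesis
  proof (cases "Im z = 0")
    case True
    then have "z = of_real (Re z)" by (simp add: complex_eq_iff)
    then have "poly p (Re z) = 0" using z poly_of_real[of p "Re z"] by simp
    then obtain q where q: "p = [:- Re z, 1:] * q" by (auto simp: poly_eq_0_iff_dvd)
    let ?w = "poly_apply Z q v"
    have q0: "q \<noteq> 0" using q p by auto
    have "degree p = Suc (degree q)" unfolding q using q0 by (subst degree_mult_eq) auto
    then have "?w \<noteq> 0" using p q0 by (intro least) auto
    moreover have "Z ?w = Re z *\<^sub>R ?w"
      using p(5) unfolding q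
      by (simp only: poly_apply_mult[OF lin])
         (simp add: poly_apply_pCons[OF lin] linear_0[OF lin])
    ultimately show ?thesis using mem[OF p(1)] by blast
  next
    case False
    define a b where "a = Re z" and "b = Im z"
    \<comment> \<open>The real quadratic with roots \<open>a \<plusminus> i b\<close> divides \<open>p\<close>: the remainder has degree at most one and vanishes
      at \<open>z\<close>, which is not real.\<close>
    let ?s = "[:a\<^sup>2 + b\<^sup>2, - 2 * a, 1:]"
    let ?r = "p mod ?s"
    have "degree ?r < degree ?s \<or> ?r = 0"
      using degree_mod_less[of ?s p] by auto
    then have "degree ?r \<le> 1" by auto
    define c d where "c = coeff ?r 0" and "d = coeff ?r 1"
    have r: "?r = [:c, d:]"
    proof (rule poly_eqI)
      fix i
      show "coeff ?r i = coeff [:c, d:] i"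
        using \<open>degree ?r \<le> 1\<close> coeff_eq_0[of ?r i]
        by (cases i; cases "i - 1") (auto simp: c_def d_def)
    qed
    have map_mult: "map_poly complex_of_real (f * g) = map_poly complex_of_real f * map_poly complex_of_real g" for f g
      by (rule poly_eqI) (simp add: coeff_map_poly coeff_mult)
    have map_add: "map_poly complex_of_real (f + g) = map_poly complex_of_real f + map_poly complex_of_real g" for f g
      by (rule poly_eqI) (simp add: coeff_map_poly)
    have s0: "poly (map_poly complex_of_real ?s) z = 0"
      by (simp add: map_poly_pCons a_def b_def complex_eq_iff power2_eq_square algebra_simps)
    have "poly ?pc z = poly (map_poly complex_of_real (p div ?s * ?s + ?r)) z"
      by (simp only: div_mult_mod_eq)
    also have "\<dots> = poly (map_poly complex_of_real ?r) z"
      by (simp only: map_mult map_add poly_add poly_mult s0) simp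
    finally have "of_real c + z * of_real d = 0"
      using z unfolding r by (simp add: map_poly_pCons)
    then have "c = 0 \<and> d = 0" using False by (auto simp: complex_eq_iff)
    then have "?r = 0" using r by simp
    then obtain q where q: "p = ?s * q" by (auto simp: mod_eq_0_iff_dvd)
    let ?w = "poly_apply Z q v"
    have q0: "q \<noteq> 0" using q p by auto
    have "degree p = 2 + degree q" unfolding q using q0 by (subst degree_mult_eq) auto
    then have w0: "?w \<noteq> 0" using p q0 by (intro least) auto
    have wW: "?w \<in> W" using mem p by blast
    define w where "w = ?w"
    have w: "w \<in> W" "w \<noteq> 0" "w \<in> V" "Z w \<in> V" "Z w \<in> W" using wW w0 W by (auto simp: w_def)
    have "(a\<^sup>2 + b\<^sup>2) *\<^sub>R w + (Z ((- 2 * a) *\<^sub>R w + Z w)) = 0"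
      using p(5) unfolding q w_def
      by (simp only: poly_apply_mult[OF lin])
         (simp add: poly_apply_pCons[OF lin] linear_0[OF lin])
    then have "0 = ip ((a\<^sup>2 + b\<^sup>2) *\<^sub>R w + (Z ((- 2 * a) *\<^sub>R w + Z w))) w"
      by (simp add: ip_simps)
    also have "\<dots> = ip (Z w - a *\<^sub>R w) (Z w - a *\<^sub>R w) + b\<^sup>2 * ip w w"
      using sym[of "Z w" w] ip_commute[of "Z w" w] w
      by (simp add: linear_add[OF lin] linear_diff[OF lin] linear_scale[OF lin] ip_simps power2_eq_square algebra_simps)
    finally have eq: "ip (Z w - a *\<^sub>R w) (Z w - a *\<^sub>R w) + b\<^sup>2 * ip w w = 0" by simp
    have "Z w - a *\<^sub>R w \<in> V" using w subspace_V by (intro subspace_diff subspace_scale)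
    then have "ip (Z w - a *\<^sub>R w) (Z w - a *\<^sub>R w) \<ge> 0"
      by (rule ip_nonneg)
    moreover have "b\<^sup>2 * ip w w > 0" using False w ip_pos by (simp add: b_def)
    ultimately show ?thesis using eq by simp
  qed
qed

text \<open>
  An eigenspace of \<open>Y\<close> in \<open>W\<close> is invariant under \<open>X\<close> because the operators commute.
\<close>

lemma common_eigenvector:
  assumes X: "linear X" "\<And>v w. v \<in> V \<Longrightarrow> w \<in> V \<Longrightarrow> ip (X v) w = ip v (X w)"
    and Y: "linear Y" "\<And>v w. v \<in> V \<Longrightarrow> w \<in> V \<Longrightarrow> ip (Y v) w = ip v (Y w)"
    and comm: "\<And>v. v \<in> V \<Longrightarrow> X (Y v) = Y (X v)"
    and W: "subspace W" "W \<subseteq> V" "\<And>w. w \<in> W \<Longrightarrow> X w \<in> W" "\<And>w. w \<in> W \<Longrightarrow> Y w \<in> W"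
    and nz: "W \<noteq> {0}"
  shows "\<exists>w\<in>W. w \<noteq> 0 \<and> (\<exists>x y. X w = x *\<^sub>R w \<and> Y w = y *\<^sub>R w)"
proof -
  obtain w y where w: "w \<in> W" "w \<noteq> 0" "Y w = y *\<^sub>R w"
    using symmetric_eigenvector[OF Y(1) W(1,2,4)] Y(2) W(2) nz by blast
  define W' where "W' = {w \<in> W. Y w = y *\<^sub>R w}"
  have "subspace W'"
    using W(1) unfolding W'_def Real_Vector_Spaces.subspace_def
    by (auto simp: linear_0[OF Y(1)] linear_add[OF Y(1)] linear_scale[OF Y(1)] scaleR_add_right scaleR_left_commute)
  moreover have "W' \<subseteq> V" using W(2) by (auto simp: W'_def)
  moreover have "X v \<in> W'" if "v \<in> W'" for v
  proof -
    have v: "v \<in> W" "Y v = y *\<^sub>R v" using that by (auto simp: W'_def)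
    then have "Y (X v) = y *\<^sub>R X v"
      using comm[of v, symmetric] W(2) by (auto simp: linear_scale[OF X(1)])
    then show ?thesis using W(3) v by (simp add: W'_def)
  qed
  moreover have "W' \<noteq> {0}" using w by (auto simp: W'_def)
  ultimately obtain u x where "u \<in> W'" "u \<noteq> 0" "X u = x *\<^sub>R u"
    using symmetric_eigenvector[OF X(1), of W'] X(2) by blast
  then show ?thesis by (auto simp: W'_def)
qed

definition orthonormal :: "'a set \<Rightarrow> bool" where
  "orthonormal E \<longleftrightarrow> (\<forall>e\<in>E. \<forall>f\<in>E. ip e f = (if e = f then 1 else 0))"

lemma orthonormal_independent:
  assumes "orthonormal E"
  shows "independent E"
proof -
  have "u v = 0" if "finite T" "T \<subseteq> E" "(\<Sum>v\<in>T. u v *\<^sub>R v) = 0" "v \<in> T" for T u v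
  proof -
    have "0 = ip (\<Sum>v\<in>T. u v *\<^sub>R v) v" using that by (simp add: ip_simps)
    also have "\<dots> = (\<Sum>w\<in>T. u w * ip w v)" by (simp add: ip_sum_left ip_simps)
    also have "\<dots> = (\<Sum>w\<in>T. if w = v then u w else 0)"
      by (rule sum.cong) (use assms that in \<open>auto simp: orthonormal_def subset_iff\<close>)
    also have "\<dots> = u v" using that by simp
    finally show ?thesis by simp
  qed
  then show ?thesis unfolding independent_explicit_module by blast
qed

text \<open>
  An orthonormal set \<open>E\<close> of common eigenvectors has bounded cardinality, so there is a largest one.
  By symmetry of the operators its orthogonal complement is invariant; if it were nonzero, it
  would contain a further common eigenvector.
\<close>

theorem common_eigenbasis:
  assumes X: "linear X" "\<And>v. v \<in> V \<Longrightarrow> X v \<in> V"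
      "\<And>v w. v \<in> V \<Longrightarrow> w \<in> V \<Longrightarrow> ip (X v) w = ip v (X w)"
    and Y: "linear Y" "\<And>v. v \<in> V \<Longrightarrow> Y v \<in> V"
      "\<And>v w. v \<in> V \<Longrightarrow> w \<in> V \<Longrightarrow> ip (Y v) w = ip v (Y w)"
    and comm: "\<And>v. v \<in> V \<Longrightarrow> X (Y v) = Y (X v)"
  shows "\<exists>E\<subseteq>V. finite E \<and> V \<subseteq> span E \<and> orthonormal E \<and>
    (\<forall>e\<in>E. \<exists>x y. X e = x *\<^sub>R e \<and> Y e = y *\<^sub>R e)"
proof -
  define P where "P E \<longleftrightarrow> E \<subseteq> V \<and> orthonormal E \<and>
    (\<forall>e\<in>E. \<exists>x y. X e = x *\<^sub>R e \<and> Y e = y *\<^sub>R e)" for E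
  have bound: "finite E \<and> card E \<le> card B" if "P E" for E
    using independent_span_bound[OF finite_B orthonormal_independent] that V_span
    unfolding P_def by blast
  have P0: "P {}" by (simp add: P_def orthonormal_def)
  have "\<forall>E. P E \<longrightarrow> card E < Suc (card B)" using bound by (simp add: less_Suc_eq_le)
  from ex_has_greatest_nat[of P, OF P0 this]
  obtain E where E: "P E" "\<And>F. P F \<Longrightarrow> card F \<le> card E" by auto
  have EV: "E \<subseteq> V" and ortho: "orthonormal E"
    and eig: "\<And>e. e \<in> E \<Longrightarrow> \<exists>x y. X e = x *\<^sub>R e \<and> Y e = y *\<^sub>R e"
    using E(1) by (auto simp: P_def)
  have finE: "finite E" using bound E(1) by blast
  define W where "W = {v \<in> V. \<forall>e\<in>E. ip v e = 0}"
  have subW: "subspace W"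
    using subspace_V unfolding W_def Real_Vector_Spaces.subspace_def by (auto simp: ip_simps)
  have WV: "W \<subseteq> V" by (auto simp: W_def)
  have XW: "X w \<in> W" if "w \<in> W" for w
  proof -
    have "ip (X w) e = 0" if "e \<in> E" for e
    proof -
      obtain x where "X e = x *\<^sub>R e" using eig[OF \<open>e \<in> E\<close>] by blast
      then show ?thesis using X(3)[of w e] \<open>w \<in> W\<close> that EV by (auto simp: W_def ip_simps)
    qed
    then show ?thesis using X(2) that by (auto simp: W_def)
  qed
  have YW: "Y w \<in> W" if "w \<in> W" for w
  proof -
    have "ip (Y w) e = 0" if "e \<in> E" for e
    proof -
      obtain y where "Y e = y *\<^sub>R e" using eig[OF \<open>e \<in> E\<close>] by blast
      then show ?thesis using Y(3)[of w e] \<open>w \<in> W\<close> that EV by (auto simp: W_def ip_simps)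
    qed
    then show ?thesis using Y(2) that by (auto simp: W_def)
  qed
  have W0: "W = {0}"
  proof (rule ccontr)
    assume "W \<noteq> {0}"
    then obtain w x y where w: "w \<in> W" "w \<noteq> 0" "X w = x *\<^sub>R w" "Y w = y *\<^sub>R w"
      using common_eigenvector[OF X(1,3) Y(1,3) comm subW WV XW YW] by blast
    have wV: "w \<in> V" using w WV by blast
    define u where "u = (1 / sqrt (ip w w)) *\<^sub>R w"
    have pos: "0 < ip w w" using ip_pos w wV by blast
    have uW: "u \<in> W" using w subW by (auto simp: u_def intro: subspace_scale)
    have uu: "ip u u = 1" using pos by (simp add: u_def ip_simps)
    have uE: "u \<notin> E"
    proof
      assume "u \<in> E"
      then have "ip u u = 0" using uW by (auto simp: W_def)
      then show False using uu by simp
    qed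
    have ue: "ip u e = 0 \<and> ip e u = 0" if "e \<in> E" for e
    proof -
      have "ip u e = 0" using uW that by (auto simp: W_def)
      then show ?thesis using ip_commute[of e u] that EV uW WV by (simp add: subset_iff)
    qed
    have "orthonormal (insert u E)"
      using ortho uu ue uE unfolding orthonormal_def by auto
    moreover have "X u = x *\<^sub>R u" "Y u = y *\<^sub>R u"
      using w by (simp_all add: u_def linear_scale[OF X(1)] linear_scale[OF Y(1)])
    ultimately have "P (insert u E)" using E(1) uW WV unfolding P_def by blast
    then have "card (insert u E) \<le> card E" by (rule E(2))
    then show False using uE finE by simp
  qed
  have "v \<in> span E" if "v \<in> V" for v
  proof -
    let ?s = "\<Sum>e\<in>E. ip v e *\<^sub>R e"
    have "ip (v - ?s) f = 0" if "f \<in> E" for f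
    proof -
      have "ip ?s f = (\<Sum>e\<in>E. ip v e * ip e f)" by (simp add: ip_sum_left ip_simps)
      also have "\<dots> = (\<Sum>e\<in>E. if e = f then ip v e else 0)"
        by (rule sum.cong) (use ortho that in \<open>auto simp: orthonormal_def\<close>)
      also have "\<dots> = ip v f" using that finE by simp
      finally show ?thesis by (simp add: ip_simps)
    qed
    moreover have "v - ?s \<in> V"
      using that EV subspace_V by (intro subspace_diff subspace_sum subspace_scale) auto
    ultimately have "v - ?s \<in> W" by (auto simp: W_def)
    then have "v = ?s" using W0 by simp
    also have "\<dots> \<in> span E" by (intro span_sum span_scale span_base)
    finally show ?thesis .
  qed
  then show ?thesis using E(1) finE unfolding P_def by blast
qed

lemma parseval:
  assumes "orthonormal E" "finite E" "v \<in> span E" "E \<subseteq> V" "w \<in> V"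
  shows "ip v w = (\<Sum>e\<in>E. ip v e * ip w e)"
proof -
  obtain c where c: "v = (\<Sum>e\<in>E. c e *\<^sub>R e)" using assms(2,3) by (auto simp: span_finite)
  have "ip v e = c e" if "e \<in> E" for e
  proof -
    have "ip v e = (\<Sum>f\<in>E. c f * ip f e)" by (simp add: c ip_sum_left ip_simps)
    also have "\<dots> = (\<Sum>f\<in>E. if f = e then c f else 0)"
      by (rule sum.cong) (use assms(1) that in \<open>auto simp: orthonormal_def\<close>)
    finally show ?thesis using that assms(2) by simp
  qed
  then have "v = (\<Sum>e\<in>E. ip v e *\<^sub>R e)" using c by simp
  then have "ip v w = ip (\<Sum>e\<in>E. ip v e *\<^sub>R e) w" by (rule arg_cong)
  also have "\<dots> = (\<Sum>e\<in>E. ip v e * ip e w)" by (simp add: ip_sum_left ip_simps)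
  also have "\<dots> = (\<Sum>e\<in>E. ip v e * ip w e)"
    by (rule sum.cong) (use ip_commute assms(4,5) in auto)
  finally show ?thesis .
qed

end

section \<open>Ranks of kernels in diagonal form\<close>

text \<open>
  The functions \<open>\<phi>\<close> form the columns of a matrix, the kernel is \<open>\<phi> diag(d) \<phi>\<^sup>T\<close>, and its rank is that
  of \<open>diag(d)\<close> when the columns of \<open>\<phi>\<close> are independent. Independence is expressed by a dual system \<open>h\<close>,
  because \<open>h\<close> also recovers each column of \<open>\<phi>\<close> with \<open>d \<noteq> 0\<close> from those of the kernel.
\<close>

lemma dim_columns_biorthogonal:
  fixes \<phi> h :: "'p \<Rightarrow> 'i \<Rightarrow> real" and d :: "'p \<Rightarrow> real"
  assumes S: "finite S" and P: "finite P"
    and dual: "\<And>p q. p \<in> P \<Longrightarrow> q \<in> P \<Longrightarrow> (\<Sum>u\<in>S. h p u * \<phi> q u) = (if p = q then 1 else 0)"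
  shows "dim ((\<lambda>c r. if r \<in> S then (\<Sum>p\<in>P. d p * \<phi> p r * \<phi> p c) else 0) ` S) =
         card {p \<in> P. d p \<noteq> 0}"
proof -
  let ?Q = "{p \<in> P. d p \<noteq> 0}"
  define \<psi> where "\<psi> p = (\<lambda>r. if r \<in> S then \<phi> p r else 0)" for p
  define K where "K c = (\<lambda>r. if r \<in> S then (\<Sum>p\<in>P. d p * \<phi> p r * \<phi> p c) else 0)" for c
  have dual': "(\<Sum>u\<in>S. h p u * \<psi> q u) = (if p = q then 1 else 0)" if "p \<in> P" "q \<in> P" for p q
    using dual[OF that] by (simp add: \<psi>_def)
  have indep: "c q = 0" if "(\<Sum>p\<in>?Q. c p *\<^sub>R \<psi> p) = 0" "q \<in> ?Q" for c q
  proof -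
    have "(\<Sum>p\<in>?Q. c p *\<^sub>R \<psi> p) u = 0" for u using that(1) by simp
    then have "0 = (\<Sum>u\<in>S. h q u * (\<Sum>p\<in>?Q. c p * \<psi> p u))"
      by (simp add: sum.neutral)
    also have "\<dots> = (\<Sum>p\<in>?Q. c p * (\<Sum>u\<in>S. h q u * \<psi> p u))"
      by (subst sum.swap[of _ _ S] | simp add: sum_distrib_left mult_ac)+
    also have "\<dots> = (\<Sum>p\<in>?Q. if p = q then c p else 0)"
      by (rule sum.cong) (use that dual' in auto)
    also have "\<dots> = c q" using that P by simp
    finally show ?thesis by simp
  qed
  have inj: "inj_on \<psi> ?Q"
  proof (rule inj_onI)
    fix p q assume "p \<in> ?Q" "q \<in> ?Q" "\<psi> p = \<psi> q"
    then show "p = q" using dual'[of p p] dual'[of p q] by (auto split: if_splits)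
  qed
  have ind: "independent (\<psi> ` ?Q)"
  proof (rule independent_if_scalars_zero)
    fix f x assume "(\<Sum>x\<in>\<psi> ` ?Q. f x *\<^sub>R x) = 0" "x \<in> \<psi> ` ?Q"
    then show "f x = 0" using indep[of "f \<circ> \<psi>"] by (auto simp: sum.reindex[OF inj])
  qed (use P in simp)
  have K: "K c = (\<Sum>p\<in>?Q. (d p * \<phi> p c) *\<^sub>R \<psi> p)" for c
  proof
    fix r
    have "(\<Sum>p\<in>P. d p * \<phi> p r * \<phi> p c) = (\<Sum>p\<in>?Q. d p * \<phi> p r * \<phi> p c)"
      by (rule sum.mono_neutral_right) (use P in auto)
    then show "K c r = (\<Sum>p\<in>?Q. (d p * \<phi> p c) *\<^sub>R \<psi> p) r"
      by (simp add: K_def \<psi>_def mult_ac)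
  qed
  have sub1: "K ` S \<subseteq> span (\<psi> ` ?Q)"
    unfolding K by (rule image_subsetI) (intro span_sum span_scale span_base imageI)
  have sub2: "\<psi> ` ?Q \<subseteq> span (K ` S)"
  proof
    fix y assume "y \<in> \<psi> ` ?Q"
    then obtain q where q: "q \<in> ?Q" "y = \<psi> q" by blast
    have "(\<Sum>u\<in>S. (h q u / d q) *\<^sub>R K u) =
        (\<Sum>u\<in>S. \<Sum>p\<in>?Q. (h q u / d q * (d p * \<phi> p u)) *\<^sub>R \<psi> p)"
      unfolding K by (simp add: scaleR_sum_right)
    also have "\<dots> = (\<Sum>p\<in>?Q. (\<Sum>u\<in>S. h q u * \<phi> p u * (d p / d q)) *\<^sub>R \<psi> p)"
      by (subst sum.swap) (simp add: scaleR_sum_left mult_ac)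
    also have "\<dots> = (\<Sum>p\<in>?Q. if p = q then \<psi> p else 0)"
      by (rule sum.cong[OF refl]) (use q dual in \<open>auto simp flip: sum_distrib_right sum_divide_distrib\<close>)
    also have "\<dots> = y" using q P by simp
    finally show "y \<in> span (K ` S)"
      by (metis (no_types, lifting) span_sum span_scale span_base imageI)
  qed
  have "span (\<psi> ` ?Q) = span (K ` S)"
    by (intro subset_antisym span_minimal subspace_span sub1 sub2)
  then have "dim (K ` S) = card (\<psi> ` ?Q)" using ind by (rule dim_eq_card)
  then show ?thesis using card_image[OF inj] by (simp add: K_def)
qed

section \<open>Flat kernels\<close>

text \<open>
  The monomial with exponents \<open>u\<close> at the point \<open>p = (x, y)\<close>. As for moments, the first exponent
  belongs to \<open>y\<close>.
\<close>

definition eval_monom :: "real \<times> real \<Rightarrow> nat \<times> nat \<Rightarrow> real" where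
  "eval_monom p u = snd p ^ fst u * fst p ^ snd u"

lemma eval_monom_add: "eval_monom p (u + v) = eval_monom p u * eval_monom p v"
  by (simp add: eval_monom_def power_add mult_ac)

lemma deg_add: "deg (u + v) = deg u + deg v"
  by (simp add: deg_def)

lemma finite_deg_le: "finite {u. deg u \<le> l}"
  by (simp flip: set_multi_indices)

text \<open>
  The set \<open>J\<close> indexes monomials that are a basis of the polynomials of degree at most \<open>l + 1\<close>
  modulo the kernel of the form, and \<open>a u\<close> holds the coordinates of the monomial \<open>u\<close> in this basis.
\<close>

locale flat_frame =
  fixes \<gamma> :: "nat \<times> nat \<Rightarrow> real" and l :: nat
    and J :: "(nat \<times> nat) set" and a :: "nat \<times> nat \<Rightarrow> nat \<times> nat \<Rightarrow> real"
  assumes J_deg: "u \<in> J \<Longrightarrow> deg u \<le> l"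
    and gram_pos: "(\<And>u. u \<notin> J \<Longrightarrow> c u = 0) \<Longrightarrow> c \<noteq> 0 \<Longrightarrow>
      0 < (\<Sum>u\<in>J. \<Sum>v\<in>J. c u * c v * \<gamma> (u + v))"
    and a_support: "deg u \<le> Suc l \<Longrightarrow> v \<notin> J \<Longrightarrow> a u v = 0"
    and a_represents: "deg u \<le> Suc l \<Longrightarrow> deg v \<le> Suc l \<Longrightarrow>
      \<gamma> (u + v) = (\<Sum>w\<in>J. a u w * \<gamma> (w + v))"
begin

definition V :: "(nat \<times> nat \<Rightarrow> real) set" where
  "V = {c. \<forall>u. u \<notin> J \<longrightarrow> c u = 0}"

definition ip :: "(nat \<times> nat \<Rightarrow> real) \<Rightarrow> (nat \<times> nat \<Rightarrow> real) \<Rightarrow> real" where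
  "ip c d = (\<Sum>u\<in>J. \<Sum>v\<in>J. c u * d v * \<gamma> (u + v))"

definition mult :: "nat \<times> nat \<Rightarrow> (nat \<times> nat \<Rightarrow> real) \<Rightarrow> (nat \<times> nat \<Rightarrow> real)" where
  "mult \<epsilon> c = (\<Sum>u\<in>J. c u *\<^sub>R a (u + \<epsilon>))"

definition unit_at :: "nat \<times> nat \<Rightarrow> nat \<times> nat \<Rightarrow> real" where
  "unit_at u = (\<lambda>v. if v = u then 1 else 0)"

lemma finite_J: "finite J"
  by (rule finite_subset[OF _ finite_deg_le[of l]]) (auto intro: J_deg)

lemma sum_unit_at_left: "(\<Sum>u\<in>J. c u * unit_at u v) = (if v \<in> J then c v else 0)"
proof -
  have "(\<Sum>u\<in>J. c u * unit_at u v) = (\<Sum>u\<in>J. if u = v then c u else 0)"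
    by (rule sum.cong) (auto simp: unit_at_def)
  then show ?thesis using finite_J by simp
qed

lemma sum_unit_at_right: "(\<Sum>w\<in>J. unit_at u w * f w) = (if u \<in> J then f u else 0)"
proof -
  have "(\<Sum>w\<in>J. unit_at u w * f w) = (\<Sum>w\<in>J. if w = u then f w else 0)"
    by (rule sum.cong) (auto simp: unit_at_def)
  then show ?thesis using finite_J by simp
qed

lemma unit_at_expand:
  assumes "c \<in> V"
  shows "c = (\<Sum>u\<in>J. c u *\<^sub>R unit_at u)"
proof
  fix v
  show "c v = (\<Sum>u\<in>J. c u *\<^sub>R unit_at u) v"
    using assms unfolding V_def by (cases v) (simp add: sum_unit_at_left)
qed

sublocale inner_product_on V ip "unit_at ` J"
proof
  show "subspace V" by (auto simp: V_def Real_Vector_Spaces.subspace_def)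
  show "finite (unit_at ` J)" using finite_J by simp
  show "V \<subseteq> span (unit_at ` J)"
  proof
    fix c assume "c \<in> V"
    then have "c = (\<Sum>u\<in>J. c u *\<^sub>R unit_at u)" by (rule unit_at_expand)
    also have "\<dots> \<in> span (unit_at ` J)" by (intro span_sum span_scale span_base) auto
    finally show "c \<in> span (unit_at ` J)" .
  qed
  show "bilinear ip"
    unfolding bilinear_def ip_def
    by (auto intro!: linearI simp: sum.distrib algebra_simps sum_distrib_left)
  show "ip v w = ip w v" for v w
    unfolding ip_def by (subst sum.swap) (simp add: add.commute mult_ac)
  show "0 < ip v v" if "v \<in> V" "v \<noteq> 0" for v
    unfolding ip_def by (rule gram_pos) (use that in \<open>auto simp: V_def\<close>)
qed

lemma a_in_V: "deg u \<le> Suc l \<Longrightarrow> a u \<in> V"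
  by (simp add: V_def a_support)

lemma ip_a_right:
  assumes "deg v \<le> Suc l"
  shows "ip c (a v) = (\<Sum>w\<in>J. c w * \<gamma> (w + v))"
  unfolding ip_def
proof (rule sum.cong[OF refl])
  fix w assume "w \<in> J"
  then have "deg w \<le> Suc l" using J_deg[of w] by simp
  then have "\<gamma> (v + w) = (\<Sum>x\<in>J. a v x * \<gamma> (x + w))" by (rule a_represents[OF assms])
  then show "(\<Sum>x\<in>J. c w * a v x * \<gamma> (w + x)) = c w * \<gamma> (w + v)"
    by (simp add: sum_distrib_left mult_ac add.commute)
qed

lemma ip_a_a: "deg u \<le> Suc l \<Longrightarrow> deg v \<le> Suc l \<Longrightarrow> ip (a u) (a v) = \<gamma> (u + v)"
  by (simp add: ip_a_right a_represents[of u v])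

text \<open>
  For \<open>u\<close> in \<open>J\<close> the pairing with \<open>a u\<close> is the pairing with the unit vector at \<open>u\<close>, and these span \<open>V\<close>.
\<close>

lemma eqI_ip_a:
  assumes "c \<in> V" "d \<in> V" "\<And>u. u \<in> J \<Longrightarrow> ip c (a u) = ip d (a u)"
  shows "c = d"
proof (rule ccontr)
  let ?e = "c - d"
  assume "c \<noteq> d"
  have e: "?e \<in> V" using assms(1,2) subspace_V by (intro subspace_diff)
  have "ip ?e ?e = (\<Sum>u\<in>J. ?e u * (\<Sum>w\<in>J. ?e w * \<gamma> (w + u)))"
    by (simp only: ip_def sum_distrib_left mult_ac add.commute)
  also have "\<dots> = (\<Sum>u\<in>J. ?e u * ip ?e (a u))"
    by (rule sum.cong[OF refl]) (use ip_a_right J_deg in \<open>simp add: le_SucI\<close>)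
  also have "\<dots> = 0" using assms(3) by (simp add: ip_simps)
  finally show False using ip_pos[OF e] \<open>c \<noteq> d\<close> by simp
qed

lemma a_basis:
  assumes "u \<in> J"
  shows "a u = unit_at u"
proof (rule eqI_ip_a)
  have du: "deg u \<le> Suc l" using J_deg[OF assms] by simp
  then show "a u \<in> V" by (rule a_in_V)
  show "unit_at u \<in> V" using assms by (auto simp: V_def unit_at_def)
  fix v assume "v \<in> J"
  then have dv: "deg v \<le> Suc l" using J_deg[of v] by simp
  show "ip (a u) (a v) = ip (unit_at u) (a v)"
    unfolding ip_a_a[OF du dv] using assms
    by (simp only: ip_a_right[OF dv] sum_unit_at_right if_True)
qed

lemma a_expand:
  assumes "c \<in> V"
  shows "c = (\<Sum>u\<in>J. c u *\<^sub>R a u)"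
proof -
  have "(\<Sum>u\<in>J. c u *\<^sub>R a u) = (\<Sum>u\<in>J. c u *\<^sub>R unit_at u)"
    by (rule sum.cong) (simp_all add: a_basis)
  then show ?thesis using unit_at_expand[OF assms] by (rule trans[OF _ sym, rotated])
qed

lemma linear_mult: "linear (mult \<epsilon>)"
  unfolding mult_def
  by (rule linearI) (simp_all add: scaleR_add_left sum.distrib scaleR_sum_right)

lemma mult_in_V:
  assumes "deg \<epsilon> = 1"
  shows "mult \<epsilon> c \<in> V"
  unfolding mult_def
  by (intro subspace_sum[OF subspace_V] subspace_scale[OF subspace_V] a_in_V)
     (use assms J_deg in \<open>auto simp: deg_add\<close>)

lemma ip_mult_a:
  assumes "deg \<epsilon> = 1" "deg u \<le> Suc l"
  shows "ip (mult \<epsilon> c) (a u) = (\<Sum>w\<in>J. c w * \<gamma> (w + \<epsilon> + u))"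
  unfolding mult_def ip_sum_left ip_simps
  by (rule sum.cong[OF refl]) (use assms J_deg in \<open>simp add: ip_a_a deg_add\<close>)

text \<open>
  Both sides are the functional applied to the product of \<open>c\<close>, \<open>d\<close> and the monomial \<open>\<epsilon>\<close>.
\<close>

lemma mult_symmetric:
  assumes \<epsilon>: "deg \<epsilon> = 1" and cd: "c \<in> V" "d \<in> V"
  shows "ip (mult \<epsilon> c) d = ip c (mult \<epsilon> d)"
proof -
  have *: "ip (mult \<epsilon> c) d = (\<Sum>v\<in>J. \<Sum>u\<in>J. c u * d v * \<gamma> (u + \<epsilon> + v))"
    if "d \<in> V" for c d
  proof -
    have "ip (mult \<epsilon> c) d = (\<Sum>v\<in>J. d v * ip (mult \<epsilon> c) (a v))"
      by (subst a_expand[OF that]) (simp add: ip_sum_right ip_simps)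
    then show ?thesis
      using ip_mult_a[OF \<epsilon>] J_deg by (simp add: le_SucI sum_distrib_left mult_ac)
  qed
  have "ip c (mult \<epsilon> d) = ip (mult \<epsilon> d) c"
    by (rule ip_commute) (use cd mult_in_V[OF \<epsilon>] in auto)
  also have "\<dots> = ip (mult \<epsilon> c) d"
    unfolding *[OF cd(1)] *[OF cd(2)]
    by (subst sum.swap) (simp add: mult_ac add_ac)
  finally show ?thesis ..
qed

text \<open>
  By definition this holds for \<open>u\<close> in \<open>J\<close>. The general case says that multiplication does not depend
  on the chosen representatives, and it follows from symmetry.
\<close>

lemma mult_a:
  assumes \<epsilon>: "deg \<epsilon> = 1" and u: "deg u \<le> l"
  shows "mult \<epsilon> (a u) = a (u + \<epsilon>)"
proof (rule eqI_ip_a)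
  have du: "deg u \<le> Suc l" "deg (u + \<epsilon>) \<le> Suc l" using u \<epsilon> by (simp_all add: deg_add)
  show "mult \<epsilon> (a u) \<in> V" by (rule mult_in_V[OF \<epsilon>])
  show "a (u + \<epsilon>) \<in> V" by (rule a_in_V) fact
  fix v assume v: "v \<in> J"
  have dv: "deg v \<le> Suc l" "deg (\<epsilon> + v) \<le> Suc l" using J_deg[OF v] \<epsilon> by (simp_all add: deg_add)
  have "ip (mult \<epsilon> (a u)) (a v) = (\<Sum>w\<in>J. a u w * \<gamma> (w + (\<epsilon> + v)))"
    by (simp add: ip_mult_a[OF \<epsilon> dv(1)] add.assoc)
  also have "\<dots> = ip (a (u + \<epsilon>)) (a v)"
    by (simp add: a_represents[OF du(1) dv(2), symmetric] ip_a_a[OF du(2) dv(1)] add.assoc)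
  finally show "ip (mult \<epsilon> (a u)) (a v) = ip (a (u + \<epsilon>)) (a v)" .
qed

text \<open>
  Tested against \<open>a u\<close>, one factor is moved to the other side by symmetry. Both sides become the
  functional applied to the product of \<open>c\<close> with the monomials \<open>\<epsilon>\<close>, \<open>\<delta>\<close> and \<open>u\<close>; moving a factor keeps
  all degrees at most \<open>l + 1\<close>, where the form is given by \<open>\<gamma>\<close>.
\<close>

lemma mult_commute:
  assumes \<epsilon>: "deg \<epsilon> = 1" and \<delta>: "deg \<delta> = 1" and c: "c \<in> V"
  shows "mult \<epsilon> (mult \<delta> c) = mult \<delta> (mult \<epsilon> c)"
proof (rule eqI_ip_a)
  fix u assume u: "u \<in> J"
  have *: "ip (mult \<epsilon> (mult \<delta> c)) (a u) = (\<Sum>w\<in>J. c w * \<gamma> (w + \<delta> + (u + \<epsilon>)))"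
    if "deg \<epsilon> = 1" "deg \<delta> = 1" for \<epsilon> \<delta>
  proof -
    have "ip (mult \<epsilon> (mult \<delta> c)) (a u) = ip (mult \<delta> c) (mult \<epsilon> (a u))"
      by (rule mult_symmetric[OF that(1) mult_in_V[OF that(2)] a_in_V]) (use J_deg[OF u] in simp)
    also have "\<dots> = (\<Sum>w\<in>J. c w * \<gamma> (w + \<delta> + (u + \<epsilon>)))"
      unfolding mult_a[OF that(1) J_deg[OF u]]
      by (rule ip_mult_a[OF that(2)]) (use J_deg[OF u] that in \<open>simp add: deg_add\<close>)
    finally show ?thesis .
  qed
  show "ip (mult \<epsilon> (mult \<delta> c)) (a u) = ip (mult \<delta> (mult \<epsilon> c)) (a u)"
    unfolding *[OF \<epsilon> \<delta>] *[OF \<delta> \<epsilon>] by (simp add: add_ac)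
qed (intro mult_in_V \<epsilon> \<delta>)+

text \<open>
  For a common eigenvector \<open>e\<close>, the pairing of \<open>a u\<close> with \<open>e\<close> is the monomial \<open>u\<close> at the pair of
  eigenvalues times the coordinate \<open>\<kappa> e\<close> of the constant polynomial, so Parseval's identity for
  \<open>\<gamma> (v + w) = ip (a v) (a w)\<close> is the quadrature formula with masses \<open>(\<kappa> e)\<^sup>2\<close>. Expanding \<open>e\<close> in
  the vectors \<open>a u\<close> turns orthonormality into duality between coefficient vectors and point
  evaluations (\<open>pairing\<close>), which forces \<open>\<kappa> e \<noteq> 0\<close> and separates the points. The dual system \<open>h\<close> is
  part of the conclusion because positivity and rank of the localizing matrices are read off from it.
\<close>

theorem atomic_representation:
  "\<exists>P \<rho> h. finite P \<and> card P = card J \<and> (\<forall>p\<in>P. 0 < \<rho> p) \<and>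
     (\<forall>u. deg u \<le> 2 * l + 2 \<longrightarrow> \<gamma> u = (\<Sum>p\<in>P. \<rho> p * eval_monom p u)) \<and>
     (\<forall>p\<in>P. \<forall>q\<in>P. (\<Sum>u\<in>J. h p u * eval_monom q u) = (if p = q then 1 else 0))"
proof -
  have ex: "deg (0, 1) = 1" and ey: "deg (1, 0) = 1" by (simp_all add: deg_def)
  obtain E where E: "E \<subseteq> V" "finite E" "V \<subseteq> span E" "orthonormal E"
    and eig: "\<forall>e\<in>E. \<exists>x y. mult (0, 1) e = x *\<^sub>R e \<and> mult (1, 0) e = y *\<^sub>R e"
    using common_eigenbasis[OF linear_mult mult_in_V[OF ex] mult_symmetric[OF ex]
        linear_mult mult_in_V[OF ey] mult_symmetric[OF ey] mult_commute[OF ex ey]]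
    by blast
  then obtain fx fy where fx: "\<And>e. e \<in> E \<Longrightarrow> mult (0, 1) e = fx e *\<^sub>R e"
    and fy: "\<And>e. e \<in> E \<Longrightarrow> mult (1, 0) e = fy e *\<^sub>R e"
    by metis
  define pt where "pt e = (fx e, fy e)" for e
  define \<kappa> where "\<kappa> e = ip (a (0, 0)) e" for e
  have ip_a_e: "ip (a u) e = eval_monom (pt e) u * \<kappa> e" if "e \<in> E" "deg u \<le> Suc l" for e u
  proof -
    have eV: "e \<in> V" using E that by blast
    have Y: "ip (a (i, 0)) e = fy e ^ i * \<kappa> e" if "i \<le> Suc l" for i
      using that
    proof (induction i)
      case (Suc i)
      have "a (Suc i, 0) = mult (1, 0) (a (i, 0))"
        using mult_a[OF ey, of "(i, 0)"] Suc.prems by (simp add: deg_def)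
      then have "ip (a (Suc i, 0)) e = ip (a (i, 0)) (mult (1, 0) e)"
        using mult_symmetric[OF ey a_in_V eV, of "(i, 0)"] Suc.prems by (simp add: deg_def)
      then show ?case using Suc fy[OF \<open>e \<in> E\<close>] by (simp add: ip_simps)
    qed (simp add: \<kappa>_def)
    have X: "ip (a (i, j)) e = fy e ^ i * fx e ^ j * \<kappa> e" if "i + j \<le> Suc l" for i j
      using that
    proof (induction j)
      case 0
      then show ?case using Y[of i] by simp
    next
      case (Suc j)
      have "a (i, Suc j) = mult (0, 1) (a (i, j))"
        using mult_a[OF ex, of "(i, j)"] Suc.prems by (simp add: deg_def)
      then have "ip (a (i, Suc j)) e = ip (a (i, j)) (mult (0, 1) e)"
        using mult_symmetric[OF ex a_in_V eV, of "(i, j)"] Suc.prems by (simp add: deg_def)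
      then show ?case using Suc fx[OF \<open>e \<in> E\<close>] by (simp add: ip_simps)
    qed
    show ?thesis
      using X[of "fst u" "snd u"] that(2) by (simp add: deg_def eval_monom_def pt_def)
  qed
  have pairing: "(\<Sum>u\<in>J. e u * eval_monom (pt f) u) * \<kappa> f = (if e = f then 1 else 0)"
    if "e \<in> E" "f \<in> E" for e f
  proof -
    have "ip e f = (\<Sum>u\<in>J. e u * ip (a u) f)"
      using E(1) that by (subst a_expand[of e]) (auto simp: ip_sum_left ip_simps)
    also have "\<dots> = (\<Sum>u\<in>J. e u * eval_monom (pt f) u) * \<kappa> f"
      unfolding sum_distrib_right
      by (rule sum.cong[OF refl]) (use ip_a_e that J_deg in \<open>simp add: le_SucI\<close>)
    finally show ?thesis using E(4) that by (simp add: orthonormal_def)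
  qed
  have \<kappa>0: "\<kappa> e \<noteq> 0" if "e \<in> E" for e using pairing[OF that that] by auto
  have inj: "inj_on pt E"
  proof (rule inj_onI, rule ccontr)
    fix e f assume ef: "e \<in> E" "f \<in> E" "pt e = pt f" "e \<noteq> f"
    then have "(\<Sum>u\<in>J. e u * eval_monom (pt e) u) * \<kappa> f = 0" using pairing[of e f] by simp
    then show False using pairing[of e e] \<kappa>0[of f] ef by simp
  qed
  define e_of where "e_of = inv_into E pt"
  have e_of: "e_of (pt e) = e" if "e \<in> E" for e
    using that inj by (simp add: e_of_def inv_into_f_f)
  let ?\<rho> = "\<lambda>p. (\<kappa> (e_of p))\<^sup>2" and ?h = "\<lambda>p u. \<kappa> (e_of p) * e_of p u"
  have "card (pt ` E) = card J"
  proof -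
    have "card E = dim V"
      using dim_unique[OF E(1,3) orthonormal_independent[OF E(4)] refl] by simp
    moreover have "dim V = card J"
    proof -
      have injJ: "inj_on unit_at J"
        by (rule inj_onI) (metis unit_at_def zero_neq_one)
      have "independent (unit_at ` J)"
      proof (rule independent_if_scalars_zero)
        fix f x assume sum: "(\<Sum>x\<in>unit_at ` J. f x *\<^sub>R x) = 0" and x: "x \<in> unit_at ` J"
        obtain u where u: "u \<in> J" "x = unit_at u" using x by blast
        have "(\<Sum>v\<in>J. f (unit_at v) *\<^sub>R unit_at v) = 0"
          using sum by (simp add: sum.reindex[OF injJ])
        from fun_cong[OF this, of u] have "(\<Sum>v\<in>J. f (unit_at v) * unit_at v u) = 0"
          by simp
        then show "f x = 0" unfolding sum_unit_at_left using u by simp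
      qed (use finite_J in simp)
      moreover have "unit_at ` J \<subseteq> V" by (auto simp: V_def unit_at_def)
      ultimately have "dim V = card (unit_at ` J)"
        using dim_unique[OF _ V_span] by blast
      then show ?thesis using card_image[OF injJ] by simp
    qed
    ultimately show ?thesis using card_image[OF inj] by simp
  qed
  moreover have "\<gamma> u = (\<Sum>p\<in>pt ` E. ?\<rho> p * eval_monom p u)" if "deg u \<le> 2 * l + 2" for u
  proof -
    \<comment> \<open>Split the monomial into two factors of degree at most \<open>l + 1\<close>.\<close>
    obtain v w where vw: "u = v + w" "deg v \<le> Suc l" "deg w \<le> Suc l"
    proof -
      let ?i = "min (fst u) (Suc l)"
      let ?j = "min (snd u) (Suc l - ?i)"
      show thesis
        by (rule that[of "(?i, ?j)" "(fst u - ?i, snd u - ?j)"])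
           (use \<open>deg u \<le> 2 * l + 2\<close> in \<open>auto simp: deg_def min_def prod_eq_iff\<close>)
    qed
    have "\<gamma> u = ip (a v) (a w)" using vw by (simp add: ip_a_a)
    also have "\<dots> = (\<Sum>e\<in>E. ip (a v) e * ip (a w) e)"
      using E a_in_V[OF vw(2)] a_in_V[OF vw(3)] by (intro parseval) auto
    also have "\<dots> = (\<Sum>e\<in>E. ?\<rho> (pt e) * eval_monom (pt e) u)"
    proof (rule sum.cong[OF refl])
      fix e assume e: "e \<in> E"
      show "ip (a v) e * ip (a w) e = ?\<rho> (pt e) * eval_monom (pt e) u"
        unfolding ip_a_e[OF e vw(2)] ip_a_e[OF e vw(3)] e_of[OF e] vw(1) eval_monom_add
        by (simp add: power2_eq_square)
    qed
    finally show ?thesis by (simp add: sum.reindex[OF inj])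
  qed
  moreover have "(\<Sum>u\<in>J. ?h p u * eval_monom q u) = (if p = q then 1 else 0)"
    if pq: "p \<in> pt ` E" "q \<in> pt ` E" for p q
  proof -
    obtain e f where ef: "e \<in> E" "p = pt e" "f \<in> E" "q = pt f" using pq by blast
    have "(\<Sum>u\<in>J. ?h p u * eval_monom q u) = \<kappa> e * (\<Sum>u\<in>J. e u * eval_monom (pt f) u)"
      using ef by (simp add: e_of sum_distrib_left mult_ac)
    also have "\<dots> = (if p = q then 1 else 0)"
      using pairing[of e f] \<kappa>0[of f] ef inj by (auto simp: field_simps inj_on_eq_iff)
    finally show ?thesis .
  qed
  moreover have "\<forall>p\<in>pt ` E. 0 < ?\<rho> p" using \<kappa>0 by (auto simp: e_of)
  ultimately show ?thesis
    using E(2) by (intro exI[of _ "pt ` E"] exI[of _ ?\<rho>] exI[of _ ?h]) auto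
qed

end

text \<open>
  The column of the moment matrix of degree \<open>l\<close> at the monomial \<open>u\<close>, extended by zero.
\<close>

definition moment_column :: "(nat \<times> nat \<Rightarrow> real) \<Rightarrow> nat \<Rightarrow> nat \<times> nat \<Rightarrow> nat \<times> nat \<Rightarrow> real" where
  "moment_column \<gamma> l u = (\<lambda>v. if deg v \<le> l then \<gamma> (v + u) else 0)"

text \<open>
  The form at \<open>c + t e\<^sub>w\<close>, with \<open>e\<^sub>w\<close> the unit vector at \<open>w\<close>, is \<open>2 t b + t\<^sup>2 K w w\<close>, where \<open>b\<close> is the sum in
  question; this is negative for small \<open>t\<close> of sign opposite to \<open>b\<close>.
\<close>

lemma psd_null_vector:
  fixes K :: "'i \<Rightarrow> 'i \<Rightarrow> real"
  assumes S: "finite S" and sym: "\<And>u v. K u v = K v u"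
    and psd: "\<And>c. 0 \<le> (\<Sum>u\<in>S. \<Sum>v\<in>S. c u * c v * K u v)"
    and null: "(\<Sum>u\<in>S. \<Sum>v\<in>S. c u * c v * K u v) = 0" and w: "w \<in> S"
  shows "(\<Sum>u\<in>S. c u * K u w) = 0"
proof -
  define b where "b = (\<Sum>u\<in>S. c u * K u w)"
  define k where "k = \<bar>K w w\<bar> + 1"
  define t where "t = - b / k"
  have k: "0 < k" by (simp add: k_def)
  then have tk: "t * k = - b" by (simp add: t_def)
  define \<delta> where "\<delta> = (\<lambda>u. if u = w then 1 else (0::real))"
  have \<delta>: "(\<Sum>v\<in>S. \<delta> v * f v) = f w" for f
    using S w by (simp add: \<delta>_def if_distrib[of "\<lambda>x. x * _"] cong: if_cong)
  have 1: "(\<Sum>u\<in>S. \<Sum>v\<in>S. c u * \<delta> v * K u v) = b"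
    using \<delta> by (simp add: b_def mult.assoc flip: sum_distrib_left)
  have 2: "(\<Sum>u\<in>S. \<Sum>v\<in>S. \<delta> u * c v * K u v) = b"
    by (subst sum.swap) (use 1 in \<open>simp add: mult_ac sym\<close>)
  have 3: "(\<Sum>u\<in>S. \<Sum>v\<in>S. \<delta> u * \<delta> v * K u v) = K w w"
    using \<delta> by (simp add: mult.assoc flip: sum_distrib_left)
  have "0 \<le> (\<Sum>u\<in>S. \<Sum>v\<in>S. (c u + t * \<delta> u) * (c v + t * \<delta> v) * K u v)"
    by (rule psd)
  also have "\<dots> = (\<Sum>u\<in>S. \<Sum>v\<in>S. c u * c v * K u v) + t * (\<Sum>u\<in>S. \<Sum>v\<in>S. c u * \<delta> v * K u v)
      + t * (\<Sum>u\<in>S. \<Sum>v\<in>S. \<delta> u * c v * K u v) + t\<^sup>2 * (\<Sum>u\<in>S. \<Sum>v\<in>S. \<delta> u * \<delta> v * K u v)"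
    by (simp add: sum_distrib_left power2_eq_square algebra_simps sum.distrib)
  also have "\<dots> = 2 * t * b + t\<^sup>2 * K w w" unfolding null 1 2 3 by simp
  also have "\<dots> \<le> 2 * t * b + t\<^sup>2 * k"
    by (simp add: mult_left_mono k_def)
  also have "\<dots> = t * b"
    by (simp add: power2_eq_square mult.assoc tk)
  finally have "b\<^sup>2 / k \<le> 0" by (simp add: t_def power2_eq_square)
  then have "b\<^sup>2 \<le> 0" using k by (simp add: divide_le_0_iff)
  then show ?thesis by (simp add: b_def)
qed

text \<open>
  Choose \<open>J\<close> such that the columns of the smaller matrix at \<open>J\<close> are a basis of its column space. The
  columns of the larger matrix at \<open>J\<close> restrict to these, so they are still independent, and by
  equality of the dimensions they span. The Gram matrix on \<open>J\<close> is definite since a null vector of the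
  form would be a linear relation between the columns at \<open>J\<close>.
\<close>

lemma flat_frame_exists:
  assumes psd: "\<And>c. 0 \<le> (\<Sum>u | deg u \<le> l. \<Sum>v | deg v \<le> l. c u * c v * \<gamma> (u + v))"
    and flat: "dim (moment_column \<gamma> (Suc l) ` {u. deg u \<le> Suc l}) =
               dim (moment_column \<gamma> l ` {u. deg u \<le> l})"
  shows "\<exists>J a. flat_frame \<gamma> l J a \<and> card J = dim (moment_column \<gamma> l ` {u. deg u \<le> l})"
proof -
  let ?f = "moment_column \<gamma> l" and ?F = "moment_column \<gamma> (Suc l)"
  let ?D = "{u. deg u \<le> l}" and ?D' = "{u. deg u \<le> Suc l}"
  obtain B where B: "B \<subseteq> ?f ` ?D" "independent B" "?f ` ?D \<subseteq> span B" "card B = dim (?f ` ?D)"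
    by (rule basis_exists)
  obtain J where J: "J \<subseteq> ?D" "inj_on ?f J" "B = ?f ` J"
    using B(1) unfolding subset_image_inj by blast
  have finJ: "finite J" using J(1) finite_deg_le finite_subset by blast
  have cardJ: "card J = dim (?f ` ?D)" using B(4) J card_image by metis
  have f_ind: "c u = 0" if "(\<Sum>u\<in>J. c u *\<^sub>R ?f u) = 0" "u \<in> J" for c u
  proof -
    have "(\<Sum>x\<in>B. c (inv_into J ?f x) *\<^sub>R x) = 0"
      using that(1) J(2) by (simp add: J(3) sum.reindex)
    from independentD[OF B(2) _ subset_refl this, of "?f u"]
    have "c (inv_into J ?f (?f u)) = 0" using that(2) finJ J(3) by blast
    then show ?thesis using J(2) that(2) by simp
  qed
  have F_ind: "c u = 0" if "(\<Sum>u\<in>J. c u *\<^sub>R ?F u) = 0" "u \<in> J" for c u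
  proof (rule f_ind)
    show "(\<Sum>u\<in>J. c u *\<^sub>R ?f u) = 0"
    proof
      fix v
      have "(\<Sum>u\<in>J. c u *\<^sub>R ?F u) v = 0" using that(1) by simp
      then show "(\<Sum>u\<in>J. c u *\<^sub>R ?f u) v = 0 v"
        by (cases "deg v \<le> l") (simp_all add: moment_column_def)
    qed
  qed fact
  have injF: "inj_on ?F J"
  proof (rule inj_onI)
    fix u v assume uv: "u \<in> J" "v \<in> J" "?F u = ?F v"
    have "?f u = ?f v"
    proof
      fix w show "?f u w = ?f v w"
        using fun_cong[OF uv(3), of w] by (cases "deg w \<le> l") (simp_all add: moment_column_def)
    qed
    then show "u = v" using J(2) uv by (auto dest: inj_onD)
  qed
  have Find: "independent (?F ` J)"
  proof (rule independent_if_scalars_zero)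
    fix f x assume "(\<Sum>x\<in>?F ` J. f x *\<^sub>R x) = 0" "x \<in> ?F ` J"
    then show "f x = 0" using F_ind[of "f \<circ> ?F"] by (auto simp: sum.reindex[OF injF])
  qed (use finJ in simp)
  have Fspan: "?F u \<in> span (?F ` J)" if "deg u \<le> Suc l" for u
  proof (rule ccontr)
    assume notin: "?F u \<notin> span (?F ` J)"
    obtain C where C: "C \<subseteq> ?F ` ?D'" "independent C" "?F ` ?D' \<subseteq> span C" "card C = dim (?F ` ?D')"
      by (rule basis_exists)
    have "finite C" using C(1) finite_deg_le by (meson finite_imageI finite_subset)
    moreover have "independent (insert (?F u) (?F ` J))"
      using notin Find by (auto simp: independent_insert span_base)
    moreover have "insert (?F u) (?F ` J) \<subseteq> span C"
    proof -
      have "insert u J \<subseteq> ?D'" using that J(1) by (auto intro: le_SucI)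
      then have "?F ` insert u J \<subseteq> ?F ` ?D'" by (rule image_mono)
      then show ?thesis using C(3) by auto
    qed
    ultimately have "card (insert (?F u) (?F ` J)) \<le> card C"
      using independent_span_bound by blast
    moreover have "?F u \<notin> ?F ` J" using notin by (rule contrapos_nn) (rule span_base)
    ultimately have "Suc (card J) \<le> card C" using finJ card_image[OF injF] by simp
    then show False using C(4) flat cardJ by simp
  qed
  have "\<exists>b. (\<forall>v. v \<notin> J \<longrightarrow> b v = 0) \<and> ?F u = (\<Sum>w\<in>J. b w *\<^sub>R ?F w)" if du: "deg u \<le> Suc l" for u
  proof -
    obtain g where g: "?F u = (\<Sum>x\<in>?F ` J. g x *\<^sub>R x)"
      using Fspan[OF du] finJ by (auto simp: span_finite)
    show ?thesis
      by (rule exI[of _ "\<lambda>w. if w \<in> J then g (?F w) else 0"])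
         (use g in \<open>simp add: sum.reindex[OF injF]\<close>)
  qed
  then obtain a where a: "\<And>u. deg u \<le> Suc l \<Longrightarrow> (\<forall>v. v \<notin> J \<longrightarrow> a u v = 0) \<and> ?F u = (\<Sum>w\<in>J. a u w *\<^sub>R ?F w)"
    by metis
  have "flat_frame \<gamma> l J a"
  proof
    show "deg u \<le> l" if "u \<in> J" for u using that J(1) by auto
    show "a u v = 0" if "deg u \<le> Suc l" "v \<notin> J" for u v using a that by blast
    show "\<gamma> (u + v) = (\<Sum>w\<in>J. a u w * \<gamma> (w + v))" if "deg u \<le> Suc l" "deg v \<le> Suc l" for u v
    proof -
      have "?F u v = (\<Sum>w\<in>J. a u w *\<^sub>R ?F w) v" using a[OF that(1)] by metis
      then show ?thesis using that(2) by (simp add: moment_column_def add.commute)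
    qed
    fix c :: "nat \<times> nat \<Rightarrow> real"
    assume supp: "\<And>u. u \<notin> J \<Longrightarrow> c u = 0" and "c \<noteq> 0"
    have J_D: "(\<Sum>u\<in>J. c u * g u) = (\<Sum>u\<in>?D. c u * g u)" for g
      by (rule sum.mono_neutral_left) (use J(1) supp finite_deg_le in auto)
    have eq: "(\<Sum>u\<in>J. \<Sum>v\<in>J. c u * c v * \<gamma> (u + v)) = (\<Sum>u\<in>?D. \<Sum>v\<in>?D. c u * c v * \<gamma> (u + v))"
      by (simp add: mult.assoc J_D flip: sum_distrib_left)
    have "(\<Sum>u\<in>?D. \<Sum>v\<in>?D. c u * c v * \<gamma> (u + v)) \<noteq> 0"
    proof
      assume null: "(\<Sum>u\<in>?D. \<Sum>v\<in>?D. c u * c v * \<gamma> (u + v)) = 0"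
      have "(\<Sum>u\<in>J. c u *\<^sub>R ?f u) = 0"
      proof
        fix w
        show "(\<Sum>u\<in>J. c u *\<^sub>R ?f u) w = 0 w"
        proof (cases "deg w \<le> l")
          case True
          have "(\<Sum>u\<in>?D. c u * \<gamma> (u + w)) = 0"
            by (rule psd_null_vector[OF finite_deg_le _ psd null])
               (use True in \<open>simp_all add: add.commute\<close>)
          then show ?thesis using True by (simp add: moment_column_def J_D add.commute)
        qed (simp add: moment_column_def)
      qed
      then have "c u = 0" for u using f_ind supp by blast
      then show False using \<open>c \<noteq> 0\<close> by auto
    qed
    then show "0 < (\<Sum>u\<in>J. \<Sum>v\<in>J. c u * c v * \<gamma> (u + v))"
      using psd[of c] unfolding eq by linarith
  qed
  then show ?thesis using cardJ by blast
qed

section \<open>From moment matrices to atoms\<close>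

definition moment_fun :: "weight_family \<Rightarrow> nat \<times> nat \<Rightarrow> real" where
  "moment_fun \<Omega> u = moment \<Omega> (fst u) (snd u)"

lemma shifted_moment_mat_alt:
  "shifted_moment_mat l w \<Omega> = mat (length (multi_indices l)) (length (multi_indices l))
     (\<lambda>(r, c). moment_fun \<Omega> (multi_indices l ! r + multi_indices l ! c + w))"
  by (simp add: shifted_moment_mat_def moment_fun_def case_prod_beta)

lemma mat_rank_shifted_moment_mat:
  "mat_rank (shifted_moment_mat l w \<Omega>) =
   dim (moment_column (\<lambda>u. moment_fun \<Omega> (u + w)) l ` {u. deg u \<le> l})"
  unfolding shifted_moment_mat_alt
  by (subst mat_rank_kernel[OF distinct_multi_indices, of _ "\<lambda>u v. moment_fun \<Omega> (u + v + w)"])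
     (simp add: set_multi_indices moment_column_def)

lemma pos_semidef_shifted_moment_mat:
  assumes "pos_semidef (shifted_moment_mat l w \<Omega>)"
  shows "0 \<le> (\<Sum>u | deg u \<le> l. \<Sum>v | deg v \<le> l. c u * c v * moment_fun \<Omega> (u + v + w))"
  using pos_semidef_kernel[OF distinct_multi_indices assms[unfolded shifted_moment_mat_alt], of c]
  by (simp add: set_multi_indices)

text \<open>
  With \<open>\<epsilon>\<close> the exponent of a coordinate function, the shifted kernel \<open>\<gamma> (u + v + \<epsilon>)\<close> is diagonal in
  the evaluations at the atoms, with diagonal entries the mass times the coordinate. Its degrees
  stay below \<open>2 l + 2\<close>, where the quadrature formula is valid. Evaluating it on the vectors dual to
  the evaluations isolates a single coordinate.
\<close>

theorem flat_moments_atomic: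
  fixes \<gamma> :: "nat \<times> nat \<Rightarrow> real"
  assumes psd: "\<And>c. 0 \<le> (\<Sum>u | deg u \<le> l. \<Sum>v | deg v \<le> l. c u * c v * \<gamma> (u + v))"
    and psd_x: "\<And>c. 0 \<le> (\<Sum>u | deg u \<le> l. \<Sum>v | deg v \<le> l. c u * c v * \<gamma> (u + v + (0, 1)))"
    and psd_y: "\<And>c. 0 \<le> (\<Sum>u | deg u \<le> l. \<Sum>v | deg v \<le> l. c u * c v * \<gamma> (u + v + (1, 0)))"
    and flat: "dim (moment_column \<gamma> (Suc l) ` {u. deg u \<le> Suc l}) =
               dim (moment_column \<gamma> l ` {u. deg u \<le> l})"
  obtains P \<rho> where "finite P" "card P = dim (moment_column \<gamma> l ` {u. deg u \<le> l})"
    "\<And>p. p \<in> P \<Longrightarrow> 0 < \<rho> p" "P \<subseteq> {0..} \<times> {0..}"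
    "\<And>u. deg u \<le> 2 * l + 2 \<Longrightarrow> \<gamma> u = (\<Sum>p\<in>P. \<rho> p * eval_monom p u)"
    "dim (moment_column (\<lambda>u. \<gamma> (u + (0, 1))) l ` {u. deg u \<le> l}) = card {p \<in> P. fst p \<noteq> 0}"
    "dim (moment_column (\<lambda>u. \<gamma> (u + (1, 0))) l ` {u. deg u \<le> l}) = card {p \<in> P. snd p \<noteq> 0}"
proof -
  let ?D = "{u. deg u \<le> l}"
  obtain J a where frame: "flat_frame \<gamma> l J a" and cardJ: "card J = dim (moment_column \<gamma> l ` ?D)"
    using flat_frame_exists[OF psd flat] by blast
  interpret flat_frame \<gamma> l J a by (rule frame)
  obtain P \<rho> h where P: "finite P" "card P = card J" and \<rho>: "\<And>p. p \<in> P \<Longrightarrow> 0 < \<rho> p"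
    and rep: "\<And>u. deg u \<le> 2 * l + 2 \<Longrightarrow> \<gamma> u = (\<Sum>p\<in>P. \<rho> p * eval_monom p u)"
    and dualJ: "\<And>p q. p \<in> P \<Longrightarrow> q \<in> P \<Longrightarrow>
      (\<Sum>u\<in>J. h p u * eval_monom q u) = (if p = q then 1 else 0)"
    using atomic_representation by blast
  define g where "g p u = (if u \<in> J then h p u else 0)" for p u
  have dual: "(\<Sum>u\<in>?D. g p u * eval_monom q u) = (if p = q then 1 else 0)"
    if "p \<in> P" "q \<in> P" for p q
  proof -
    have "(\<Sum>u\<in>?D. g p u * eval_monom q u) = (\<Sum>u\<in>J. g p u * eval_monom q u)"
      by (rule sum.mono_neutral_right) (use finite_deg_le J_deg in \<open>auto simp: g_def\<close>)
    then show ?thesis using dualJ[OF that] by (simp add: g_def)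
  qed
  have local: "\<gamma> (u + v + \<epsilon>) =
      (\<Sum>p\<in>P. \<rho> p * eval_monom p \<epsilon> * eval_monom p u * eval_monom p v)"
    if "deg u \<le> l" "deg v \<le> l" "deg \<epsilon> = 1" for u v \<epsilon>
    using that by (subst rep) (simp_all add: deg_add eval_monom_add mult_ac)
  have coordinate: "0 \<le> eval_monom p \<epsilon>"
    if \<epsilon>: "deg \<epsilon> = 1" and p: "p \<in> P"
      and pos: "\<And>c. 0 \<le> (\<Sum>u\<in>?D. \<Sum>v\<in>?D. c u * c v * \<gamma> (u + v + \<epsilon>))" for p \<epsilon>
  proof -
    let ?d = "\<lambda>q. \<rho> q * eval_monom q \<epsilon>"
    have "0 \<le> (\<Sum>u\<in>?D. \<Sum>v\<in>?D. g p u * g p v * \<gamma> (u + v + \<epsilon>))" by (rule pos)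
    also have "\<dots> = (\<Sum>u\<in>?D. \<Sum>v\<in>?D. \<Sum>q\<in>P.
        ?d q * (g p u * eval_monom q u) * (g p v * eval_monom q v))"
      using \<epsilon> by (simp add: local sum_distrib_left mult_ac)
    also have "\<dots> = (\<Sum>u\<in>?D. \<Sum>q\<in>P. \<Sum>v\<in>?D.
        ?d q * (g p u * eval_monom q u) * (g p v * eval_monom q v))"
      by (rule sum.cong[OF refl]) (rule sum.swap)
    also have "\<dots> = (\<Sum>q\<in>P. \<Sum>u\<in>?D. \<Sum>v\<in>?D.
        ?d q * (g p u * eval_monom q u) * (g p v * eval_monom q v))"
      by (rule sum.swap)
    also have "\<dots> = (\<Sum>q\<in>P. ?d q * (\<Sum>u\<in>?D. g p u * eval_monom q u) *
        (\<Sum>v\<in>?D. g p v * eval_monom q v))"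
      by (simp only: mult.assoc sum_product) (simp add: sum_distrib_left mult_ac)
    also have "\<dots> = (\<Sum>q\<in>P. if q = p then ?d q else 0)"
      by (rule sum.cong[OF refl]) (use p in \<open>simp add: dual\<close>)
    also have "\<dots> = ?d p" using p P by simp
    finally show ?thesis using \<rho>[OF p] by (simp add: zero_le_mult_iff)
  qed
  have rank: "dim (moment_column (\<lambda>u. \<gamma> (u + \<epsilon>)) l ` ?D) = card {p \<in> P. eval_monom p \<epsilon> \<noteq> 0}"
    if \<epsilon>: "deg \<epsilon> = 1" for \<epsilon>
  proof -
    have "moment_column (\<lambda>u. \<gamma> (u + \<epsilon>)) l ` ?D =
      (\<lambda>c r. if r \<in> ?D then (\<Sum>p\<in>P. (\<rho> p * eval_monom p \<epsilon>) * eval_monom p r * eval_monom p c) else 0) ` ?D"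
      using \<epsilon> by (intro image_cong refl) (auto simp: moment_column_def fun_eq_iff local)
    also have "dim \<dots> = card {p \<in> P. \<rho> p * eval_monom p \<epsilon> \<noteq> 0}"
      by (rule dim_columns_biorthogonal[OF finite_deg_le P(1) dual])
    also have "{p \<in> P. \<rho> p * eval_monom p \<epsilon> \<noteq> 0} = {p \<in> P. eval_monom p \<epsilon> \<noteq> 0}"
      using \<rho> by force
    finally show ?thesis .
  qed
  have ev: "eval_monom p (0, 1) = fst p" "eval_monom p (1, 0) = snd p" for p
    by (simp_all add: eval_monom_def)
  have deg1: "deg (0, 1) = 1" "deg (1, 0) = 1" by (simp_all add: deg_def)
  show thesis
  proof (rule that[of P \<rho>])
    show "card P = dim (moment_column \<gamma> l ` ?D)" using P cardJ by simp
    have "0 \<le> fst p \<and> 0 \<le> snd p" if "p \<in> P" for p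
      using coordinate[OF _ that psd_x] coordinate[OF _ that psd_y] unfolding ev
      by (simp add: deg_def)
    then show "P \<subseteq> {0..} \<times> {0..}" by force
    show "dim (moment_column (\<lambda>u. \<gamma> (u + (0, 1))) l ` ?D) = card {p \<in> P. fst p \<noteq> 0}"
      using rank[OF deg1(1)] unfolding ev .
    show "dim (moment_column (\<lambda>u. \<gamma> (u + (1, 0))) l ` ?D) = card {p \<in> P. snd p \<noteq> 0}"
      using rank[OF deg1(2)] unfolding ev .
  qed (use P \<rho> rep in auto)
qed

section \<open>Finitely atomic measures\<close>

text \<open>
  A point measure has the discrete sigma-algebra on \<open>P\<close>, so it is pushed forward to the Borel sets.
\<close>

definition atomic_measure :: "(real \<times> real) set \<Rightarrow> (real \<times> real \<Rightarrow> real) \<Rightarrow> (real \<times> real) measure" where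
  "atomic_measure P \<rho> = distr (point_measure P (\<lambda>p. ennreal (\<rho> p))) borel (\<lambda>p. p)"

lemma measurable_point_measure_borel:
  "(\<lambda>p. p) \<in> measurable (point_measure P f) (borel :: (real \<times> real) measure)"
  by (simp add: measurable_point_measure_eq1)

lemma sets_atomic_measure [simp]: "sets (atomic_measure P \<rho>) = sets borel"
  by (simp add: atomic_measure_def)

lemma space_atomic_measure [simp]: "space (atomic_measure P \<rho>) = UNIV"
  by (simp add: atomic_measure_def)

lemma emeasure_atomic_measure:
  assumes "finite P" "A \<in> sets borel"
  shows "emeasure (atomic_measure P \<rho>) A = (\<Sum>p\<in>A \<inter> P. ennreal (\<rho> p))"
  unfolding atomic_measure_def
  using assms by (simp add: emeasure_distr[OF measurable_point_measure_borel] space_point_measure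
      emeasure_point_measure_finite)

lemma atoms_atomic_measure:
  assumes "finite P" "\<And>p. p \<in> P \<Longrightarrow> 0 < \<rho> p"
  shows "atoms (atomic_measure P \<rho>) = P"
proof -
  have "emeasure (atomic_measure P \<rho>) {p} = (if p \<in> P then ennreal (\<rho> p) else 0)" for p
    using assms(1) by (simp add: emeasure_atomic_measure)
  then show ?thesis using assms(2) by (auto simp: atoms_def split: if_splits)
qed

lemma supported_in_atomic_measure:
  assumes "finite P" "P \<subseteq> S" "S \<in> sets borel"
  shows "supported_in (atomic_measure P \<rho>) S"
proof -
  have "emeasure (atomic_measure P \<rho>) (UNIV - S) = (\<Sum>p\<in>(UNIV - S) \<inter> P. ennreal (\<rho> p))"
    using assms(3) by (intro emeasure_atomic_measure[OF assms(1)]) (simp add: Compl_eq_Diff_UNIV[symmetric])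
  also have "(UNIV - S) \<inter> P = {}" using assms(2) by auto
  finally show ?thesis by (simp add: supported_in_def)
qed

lemma has_moment_atomic_measure:
  assumes "finite P" "\<And>p. p \<in> P \<Longrightarrow> 0 < \<rho> p"
  shows "has_moment (atomic_measure P \<rho>) i j (\<Sum>p\<in>P. \<rho> p * eval_monom p (i, j))"
proof -
  let ?f = "\<lambda>(x :: real, y :: real). y ^ i * x ^ j"
  let ?M = "point_measure P (\<lambda>p. ennreal (\<rho> p))"
  have f: "?f \<in> borel_measurable borel"
    by (auto intro!: borel_measurable_continuous_onI continuous_intros simp: case_prod_beta)
  have "integrable ?M ?f"
    using assms by (intro integrable_point_measure_finite)
  moreover have "integral\<^sup>L ?M ?f = (\<Sum>p\<in>P. \<rho> p * eval_monom p (i, j))"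
    using assms by (subst lebesgue_integral_point_measure_finite)
      (auto simp: eval_monom_def case_prod_beta intro: less_imp_le)
  ultimately show ?thesis
    unfolding has_moment_def atomic_measure_def has_bochner_integral_iff
    by (simp add: integrable_distr_eq[OF measurable_point_measure_borel f]
        integral_distr[OF measurable_point_measure_borel f])
qed

lemma prob_space_atomic_measure:
  assumes "finite P" "\<And>p. p \<in> P \<Longrightarrow> 0 < \<rho> p" "(\<Sum>p\<in>P. \<rho> p) = 1"
  shows "prob_space (atomic_measure P \<rho>)"
proof
  have "emeasure (atomic_measure P \<rho>) UNIV = (\<Sum>p\<in>P. ennreal (\<rho> p))"
    using emeasure_atomic_measure[OF assms(1), of UNIV] by simp
  also have "\<dots> = 1"
    using assms by (subst sum_ennreal) (auto intro: less_imp_le)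
  finally show "emeasure (atomic_measure P \<rho>) (space (atomic_measure P \<rho>)) = 1" by simp
qed

section \<open>Weights and moments\<close>

lemma path_product_append:
  "path_product \<Omega> k (s @ t) = path_product \<Omega> k s *
     path_product \<Omega> (k + (count_list s Horizontal, count_list s Vertical)) t"
proof (induction s arbitrary: k)
  case Nil
  then show ?case by (cases k) simp
next
  case (Cons a s)
  then show ?case by (cases a; cases k) (simp_all add: mult.assoc)
qed

lemma count_list_replicate: "count_list (replicate n x) y = (if x = y then n else 0)"
  by (induction n) auto

text \<open>
  The canonical path goes right first, so a final horizontal step leaves it unless \<open>snd k = 0\<close>;
  commutativity makes the moment independent of the path.
\<close>

lemma moment_step_x:
  assumes "commutative_family m \<Omega>" "deg k \<le> m"
  shows "moment \<Omega> (snd k) (Suc (fst k)) = moment \<Omega> (snd k) (fst k) * (alpha \<Omega> k)\<^sup>2"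
proof -
  let ?s = "replicate (fst k) Horizontal @ replicate (snd k) Vertical"
  have "moment \<Omega> (snd k) (Suc (fst k)) = path_product \<Omega> (0, 0) (?s @ [Horizontal])"
    using assms
    by (intro path_product_eq_moment[symmetric]) (simp_all add: deg_def count_list_replicate add.commute)
  also have "\<dots> = moment \<Omega> (snd k) (fst k) * (alpha \<Omega> k)\<^sup>2"
    unfolding path_product_append[of _ _ ?s]
    by (cases k) (simp add: moment_def count_list_replicate)
  finally show ?thesis .
qed

lemma moment_step_y: "moment \<Omega> (Suc (snd k)) (fst k) = moment \<Omega> (snd k) (fst k) * (beta \<Omega> k)\<^sup>2"
proof -
  let ?s = "replicate (fst k) Horizontal @ replicate (snd k) Vertical"
  have "moment \<Omega> (Suc (snd k)) (fst k) = path_product \<Omega> (0, 0) (?s @ [Vertical])"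
    by (simp add: moment_def replicate_append_same)
  also have "\<dots> = moment \<Omega> (snd k) (fst k) * (beta \<Omega> k)\<^sup>2"
    unfolding path_product_append[of _ _ ?s]
    by (cases k) (simp add: moment_def count_list_replicate)
  finally show ?thesis .
qed

lemma path_product_telescope:
  assumes "\<And>k. g k \<noteq> 0" "\<And>k. (alpha W k)\<^sup>2 = g (k + (1, 0)) / g k"
    "\<And>k. (beta W k)\<^sup>2 = g (k + (0, 1)) / g k"
  shows "path_product W k s = g (k + (count_list s Horizontal, count_list s Vertical)) / g k"
proof (induction s arbitrary: k)
  case Nil
  then show ?case using assms(1) by (cases k) simp
next
  case (Cons a s)
  then show ?case using assms by (cases a; cases k) simp_all
qed

section \<open>Weighted composition operators\<close>

text \<open>
  Weighted shifts, the scaled bilateral shifts of the normal extension and the isometry into its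
  space all have this form.
\<close>

definition weighted_comp :: "'j set \<Rightarrow> ('j \<Rightarrow> complex) \<Rightarrow> ('j \<Rightarrow> 'i) \<Rightarrow> ('i \<Rightarrow> complex) \<Rightarrow> ('j \<Rightarrow> complex)" where
  "weighted_comp D c \<pi> f = (\<lambda>j. if j \<in> D then c j * f (\<pi> j) else 0)"

lemma weighted_comp_bound:
  assumes inj: "inj_on \<pi> D" and C: "\<And>j. j \<in> D \<Longrightarrow> cmod (c j) \<le> C" and C0: "0 \<le> C"
    and f: "f \<in> ell2"
  shows "weighted_comp D c \<pi> f \<in> ell2" "ell2_norm (weighted_comp D c \<pi> f) \<le> C * ell2_norm f"
proof -
  let ?F = "\<lambda>i. (cmod (f i))\<^sup>2" and ?G = "\<lambda>j. (cmod (weighted_comp D c \<pi> f j))\<^sup>2"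
  have F: "?F summable_on UNIV" using f by (simp add: ell2_def)
  then have "?F summable_on \<pi> ` D" by (rule summable_on_subset_banach) simp
  then have FD: "(\<lambda>j. ?F (\<pi> j)) summable_on D"
    using summable_on_reindex[OF inj, of ?F] by (simp add: o_def)
  then have CF: "(\<lambda>j. C\<^sup>2 * ?F (\<pi> j)) summable_on D" by (rule summable_on_cmult_right)
  have le: "?G j \<le> C\<^sup>2 * ?F (\<pi> j)" if "j \<in> D" for j
    using that C[OF that]
    by (simp add: weighted_comp_def norm_mult power_mult_distrib mult_right_mono power_mono)
  have GD: "?G summable_on D"
    by (rule summable_on_comparison_test[OF CF]) (use le in auto)
  have "?G summable_on UNIV \<longleftrightarrow> ?G summable_on D"
    by (rule summable_on_cong_neutral) (auto simp: weighted_comp_def)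
  then show "weighted_comp D c \<pi> f \<in> ell2" using GD by (simp add: ell2_def)
  have "infsum ?G UNIV = infsum ?G D"
    by (rule infsum_cong_neutral) (auto simp: weighted_comp_def)
  also have "\<dots> \<le> infsum (\<lambda>j. C\<^sup>2 * ?F (\<pi> j)) D"
    by (rule infsum_mono[OF GD CF le])
  also have "\<dots> = C\<^sup>2 * infsum ?F (\<pi> ` D)"
    using infsum_reindex[OF inj, of ?F] by (simp add: o_def infsum_cmult_right')
  also have "\<dots> \<le> C\<^sup>2 * infsum ?F UNIV"
    by (intro mult_left_mono infsum_mono2 F \<open>?F summable_on \<pi> ` D\<close>) auto
  finally have "sqrt (infsum ?G UNIV) \<le> sqrt (C\<^sup>2 * infsum ?F UNIV)" by simp
  then show "ell2_norm (weighted_comp D c \<pi> f) \<le> C * ell2_norm f"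
    using C0 by (simp add: ell2_norm_def real_sqrt_mult)
qed

lemma bounded_weighted_comp:
  assumes "inj_on \<pi> D" "\<And>j. j \<in> D \<Longrightarrow> cmod (c j) \<le> C"
  shows "bounded_operator (weighted_comp D c \<pi>)"
proof -
  have C: "\<And>j. j \<in> D \<Longrightarrow> cmod (c j) \<le> \<bar>C\<bar>" using assms(2) by fastforce
  note bound = weighted_comp_bound[OF assms(1) C]
  show ?thesis
    unfolding bounded_operator_def
  proof (intro conjI)
    show "\<forall>f\<in>ell2. weighted_comp D c \<pi> f \<in> ell2" using bound(1) by simp
    show "\<exists>C. \<forall>f\<in>ell2. ell2_norm (weighted_comp D c \<pi> f) \<le> C * ell2_norm f"
      using bound(2) by (intro exI[of _ "\<bar>C\<bar>"]) simp
  qed (auto simp: weighted_comp_def fun_eq_iff algebra_simps)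
qed

text \<open>
  The adjoint is the inverse permutation with conjugate weights. Since the weight is constant along the
  orbits of \<open>\<pi>\<close>, both products of the operator with its adjoint multiply by \<open>\<bar>c\<bar>\<^sup>2\<close>.
\<close>

lemma normal_weighted_permutation:
  fixes \<pi> :: "'i \<Rightarrow> 'i"
  assumes \<pi>: "bij \<pi>" and inv: "\<And>i. c (\<pi> i) = c i" and C: "\<And>i. cmod (c i) \<le> C"
  shows "normal_operator (weighted_comp UNIV c \<pi>)"
proof -
  let ?N = "weighted_comp UNIV c \<pi>"
  let ?N' = "weighted_comp UNIV (\<lambda>i. cnj (c i)) (inv_into UNIV \<pi>)"
  have c_inv: "c (inv_into UNIV \<pi> i) = c i" for i
    using inv[of "inv_into UNIV \<pi> i"] bij_is_surj[OF \<pi>] by (simp add: surj_f_inv_f)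
  have "bounded_operator ?N" using \<pi> C by (intro bounded_weighted_comp) (auto dest: bij_is_inj)
  moreover have "bounded_operator ?N'"
    using bij_is_inj[OF bij_imp_bij_inv[OF \<pi>]] C by (intro bounded_weighted_comp) auto
  moreover have "is_adjoint ?N ?N'"
    unfolding is_adjoint_def
  proof (intro ballI)
    fix f g :: "'i \<Rightarrow> complex"
    have "ell2_inner (?N f) g = (\<Sum>\<^sub>\<infinity>i. (\<lambda>j. f j * cnj (?N' g j)) (\<pi> i))"
      using bij_is_inj[OF \<pi>] by (simp add: ell2_inner_def weighted_comp_def inv mult_ac)
    also have "\<dots> = ell2_inner f (?N' g)"
      unfolding ell2_inner_def by (rule infsum_reindex_bij_betw) (rule \<pi>)
    finally show "ell2_inner (?N f) g = ell2_inner f (?N' g)" .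
  qed
  moreover have "operators_commute ?N ?N'"
    using bij_is_inj[OF \<pi>] bij_is_surj[OF \<pi>]
    by (simp add: operators_commute_def weighted_comp_def fun_eq_iff inv c_inv surj_f_inv_f)
  ultimately show ?thesis unfolding normal_operator_def by blast
qed

text \<open>
  The coordinate at \<open>k\<close> is spread over the fiber \<open>\<iota> (k, s)\<close>, \<open>s\<close> in \<open>S\<close>, with coefficients of total square
  one, and different fibers are disjoint.
\<close>

lemma weighted_comp_isometry:
  fixes \<iota> :: "'i \<times> 's \<Rightarrow> 'j"
  assumes inj: "inj_on \<iota> (UNIV \<times> S)" and S: "finite S" and D: "D = \<iota> ` (UNIV \<times> S)"
    and \<pi>: "\<And>k s. s \<in> S \<Longrightarrow> \<pi> (\<iota> (k, s)) = k"
    and unit: "\<And>k. (\<Sum>s\<in>S. (cmod (c (\<iota> (k, s))))\<^sup>2) = 1"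
  shows "linear_isometry (weighted_comp D c \<pi>)"
proof -
  let ?V = "weighted_comp D c \<pi>"
  have *: "?V f \<in> ell2 \<and> ell2_norm (?V f) = ell2_norm f" if f: "f \<in> ell2" for f
  proof -
    let ?F = "\<lambda>k. (cmod (f k))\<^sup>2" and ?G = "\<lambda>j. (cmod (?V f j))\<^sup>2"
    let ?H = "\<lambda>(k, s). (cmod (c (\<iota> (k, s))))\<^sup>2 * ?F k"
    have F: "?F summable_on UNIV" using f by (simp add: ell2_def)
    have fiber: "(\<Sum>\<^sub>\<infinity>s\<in>S. ?H (k, s)) = ?F k" for k
      using S unit[of k] by (simp flip: sum_distrib_right)
    have "(\<lambda>x. norm (?H x)) summable_on UNIV \<times> S"
      using F S unit
      by (intro iffD2[OF Infinite_Sum.abs_summable_on_Sigma_iff] conjI ballI)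
         (simp_all flip: sum_distrib_right)
    then have H: "?H summable_on UNIV \<times> S" by (rule Infinite_Sum.abs_summable_summable)
    have G: "?G (\<iota> x) = ?H x" if "x \<in> UNIV \<times> S" for x
      using that \<pi> by (auto simp: weighted_comp_def D norm_mult power_mult_distrib)
    have "?G summable_on UNIV \<longleftrightarrow> ?G summable_on D"
      by (rule summable_on_cong_neutral) (auto simp: weighted_comp_def)
    also have "\<dots> \<longleftrightarrow> (?G \<circ> \<iota>) summable_on UNIV \<times> S"
      unfolding D by (rule summable_on_reindex[OF inj])
    also have "\<dots> \<longleftrightarrow> ?H summable_on UNIV \<times> S"
      by (rule summable_on_cong) (simp only: o_apply G)
    finally have "?V f \<in> ell2" using H by (simp add: ell2_def)
    have "infsum ?G UNIV = infsum ?G D"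
      by (rule infsum_cong_neutral) (auto simp: weighted_comp_def)
    also have "\<dots> = infsum (?G \<circ> \<iota>) (UNIV \<times> S)"
      unfolding D by (rule infsum_reindex[OF inj])
    also have "\<dots> = infsum ?H (UNIV \<times> S)"
      by (rule infsum_cong) (simp only: o_apply G)
    also have "\<dots> = (\<Sum>\<^sub>\<infinity>k. \<Sum>\<^sub>\<infinity>s\<in>S. ?H (k, s))"
      by (rule infsum_Sigma_banach[OF H, symmetric])
    also have "\<dots> = infsum ?F UNIV" by (simp only: fiber)
    finally have "ell2_norm (?V f) = ell2_norm f" by (simp add: ell2_norm_def)
    with \<open>?V f \<in> ell2\<close> show ?thesis by simp
  qed
  have "bounded_operator ?V"
    unfolding bounded_operator_def
  proof (intro conjI)
    show "\<exists>C. \<forall>f\<in>ell2. ell2_norm (?V f) \<le> C * ell2_norm f"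
      using * by (intro exI[of _ 1]) simp
  qed (use * in \<open>auto simp: weighted_comp_def fun_eq_iff algebra_simps\<close>)
  then show ?thesis using * by (simp add: linear_isometry_def)
qed

section \<open>Norms of weighted shifts\<close>

lemma ell2_norm_basis_vec:
  "(\<lambda>l. c * basis_vec k l) \<in> ell2" "ell2_norm (\<lambda>l. c * basis_vec k l) = cmod c"
proof -
  let ?G = "\<lambda>l. (cmod (c * basis_vec k l))\<^sup>2"
  have "?G summable_on UNIV \<longleftrightarrow> ?G summable_on {k}"
    by (rule summable_on_cong_neutral) (auto simp: basis_vec_def)
  then show "(\<lambda>l. c * basis_vec k l) \<in> ell2" by (simp add: ell2_def)
  have "infsum ?G UNIV = infsum ?G {k}"
    by (rule infsum_cong_neutral) (auto simp: basis_vec_def)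
  then show "ell2_norm (\<lambda>l. c * basis_vec k l) = cmod c"
    by (simp add: ell2_norm_def basis_vec_def)
qed

lemma operator_norm_ge:
  assumes "bounded_operator A" "f \<in> ell2" "ell2_norm f \<le> 1"
  shows "ell2_norm (A f) \<le> operator_norm A"
proof -
  obtain C where C: "\<And>f. f \<in> ell2 \<Longrightarrow> ell2_norm (A f) \<le> C * ell2_norm f"
    using assms(1) unfolding bounded_operator_def by blast
  have "ell2_norm (A f) \<le> \<bar>C\<bar>" if "f \<in> ell2" "ell2_norm f \<le> 1" for f
  proof -
    have "0 \<le> ell2_norm f" by (simp add: ell2_norm_def infsum_nonneg)
    then have "C * ell2_norm f \<le> \<bar>C\<bar> * 1"
      using that(2) by (intro mult_mono) auto
    then show ?thesis using C[OF that(1)] by simp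
  qed
  then have "bdd_above ((\<lambda>f. ell2_norm (A f)) ` {f \<in> ell2. ell2_norm f \<le> 1})"
    by (intro bdd_aboveI2[of _ _ "\<bar>C\<bar>"]) auto
  then show ?thesis
    unfolding operator_norm_def by (rule cSUP_upper2) (use assms in auto)
qed

lemma shift1_weighted_comp:
  "shift1 W = weighted_comp {k. 0 < fst k} (\<lambda>(p, q). of_real (alpha W (p - 1, q))) (\<lambda>(p, q). (p - 1, q))"
  by (auto simp: shift1_def weighted_comp_def fun_eq_iff)

lemma shift2_weighted_comp:
  "shift2 W = weighted_comp {k. 0 < snd k} (\<lambda>(p, q). of_real (beta W (p, q - 1))) (\<lambda>(p, q). (p, q - 1))"
  by (auto simp: shift2_def weighted_comp_def fun_eq_iff)

lemma bounded_shifts: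
  assumes "shift_weights W"
  shows "bounded_operator (shift1 W)" "bounded_operator (shift2 W)"
proof -
  obtain C where C: "\<And>k. alpha W k \<le> C \<and> beta W k \<le> C" and pos: "\<And>k. 0 < alpha W k \<and> 0 < beta W k"
    using assms unfolding shift_weights_def by blast
  have "\<bar>alpha W k\<bar> \<le> C" "\<bar>beta W k\<bar> \<le> C" for k using C[of k] pos[of k] by simp_all
  then show "bounded_operator (shift1 W)" "bounded_operator (shift2 W)"
    unfolding shift1_weighted_comp shift2_weighted_comp
    by (intro bounded_weighted_comp[of _ _ _ C]; force simp: inj_on_def)+
qed

lemma weight_le_operator_norm:
  assumes "shift_weights W"
  shows "alpha W k \<le> operator_norm (shift1 W)" "beta W k \<le> operator_norm (shift2 W)"
proof -
  have e: "basis_vec k \<in> ell2" "ell2_norm (basis_vec k) \<le> 1"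
    using ell2_norm_basis_vec[of 1 k] by simp_all
  have pos: "0 < alpha W k" "0 < beta W k"
    using assms unfolding shift_weights_def by blast+
  show "alpha W k \<le> operator_norm (shift1 W)" "beta W k \<le> operator_norm (shift2 W)"
    using operator_norm_ge[OF bounded_shifts(1)[OF assms] e]
      operator_norm_ge[OF bounded_shifts(2)[OF assms] e] pos
    by (simp_all add: shift1_basis_vec shift2_basis_vec ell2_norm_basis_vec)
qed

text \<open>
  The growth bound gives power sums of order \<open>N\<^sup>n\<close>, but they dominate the contribution
  \<open>\<rho> q (x q)\<^sup>n\<close> of a single atom.
\<close>

lemma atom_le_growth:
  fixes \<rho> x :: "'p \<Rightarrow> real"
  assumes P: "finite P" "\<And>p. p \<in> P \<Longrightarrow> 0 < \<rho> p" "\<And>p. p \<in> P \<Longrightarrow> 0 \<le> x p"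
    and growth: "\<And>n. (\<Sum>p\<in>P. \<rho> p * x p ^ Suc n) \<le> N * (\<Sum>p\<in>P. \<rho> p * x p ^ n)"
    and N: "0 < N" and q: "q \<in> P"
  shows "x q \<le> N"
proof (rule ccontr)
  assume "\<not> x q \<le> N"
  then have "1 < x q / N" using N by simp
  let ?s = "\<lambda>n. \<Sum>p\<in>P. \<rho> p * x p ^ n"
  have s: "?s n \<le> N ^ n * ?s 0" for n
  proof (induction n)
    case (Suc n)
    have "N * ?s n \<le> N * (N ^ n * ?s 0)" using Suc N by (intro mult_left_mono) auto
    then show ?case using growth[of n] by (simp add: mult.assoc)
  qed simp
  obtain n where n: "?s 0 / \<rho> q < (x q / N) ^ n" using real_arch_pow[OF \<open>1 < x q / N\<close>] by blast
  have "\<rho> q * x q ^ n \<le> ?s n"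
    using P q by (intro member_le_sum mult_nonneg_nonneg zero_le_power) (auto intro: less_imp_le)
  then have "\<rho> q * x q ^ n \<le> N ^ n * ?s 0" using s[of n] by linarith
  moreover have "?s 0 * N ^ n < \<rho> q * x q ^ n"
    using n P(2)[OF q] N by (simp add: field_simps power_divide)
  ultimately show False by (simp add: mult.commute)
qed

section \<open>Weighted shifts with a finitely atomic Berger measure\<close>

locale quadrant_atoms =
  fixes P :: "(real \<times> real) set" and \<rho> :: "real \<times> real \<Rightarrow> real"
  assumes finite_P: "finite P"
    and mass_pos: "p \<in> P \<Longrightarrow> 0 < \<rho> p"
    and nonneg: "p \<in> P \<Longrightarrow> 0 \<le> fst p \<and> 0 \<le> snd p"
    and mass_total: "(\<Sum>p\<in>P. \<rho> p) = 1"
    and interior_atom: "\<exists>p\<in>P. 0 < fst p \<and> 0 < snd p"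
begin

text \<open>
  The contribution of the atom \<open>p\<close> to the moment at the lattice point \<open>k\<close>, whose first coordinate is the
  exponent of \<open>x\<close>.
\<close>

definition summand :: "real \<times> real \<Rightarrow> nat \<times> nat \<Rightarrow> real" where
  "summand p k = \<rho> p * fst p ^ fst k * snd p ^ snd k"

definition mom :: "nat \<times> nat \<Rightarrow> real" where
  "mom k = (\<Sum>p\<in>P. summand p k)"

definition W :: weight_family where
  "W k = (sqrt (mom (k + (1, 0)) / mom k), sqrt (mom (k + (0, 1)) / mom k))"

lemma summand_nonneg: "p \<in> P \<Longrightarrow> 0 \<le> summand p k"
  using mass_pos[of p] nonneg[of p] by (simp add: summand_def)

lemma mom_pos: "0 < mom k"
proof -
  obtain p where p: "p \<in> P" "0 < fst p" "0 < snd p" using interior_atom by blast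
  then have "0 < summand p k" using mass_pos[of p] by (simp add: summand_def)
  then show ?thesis unfolding mom_def
    using p(1) finite_P summand_nonneg by (intro sum_pos2[of P p]) auto
qed

lemma summand_step:
  "summand p (k + (1, 0)) = fst p * summand p k" "summand p (k + (0, 1)) = snd p * summand p k"
  by (simp_all add: summand_def)

lemma weights:
  "0 < alpha W k" "0 < beta W k"
  "(alpha W k)\<^sup>2 = mom (k + (1, 0)) / mom k" "(beta W k)\<^sup>2 = mom (k + (0, 1)) / mom k"
  using mom_pos[of k] mom_pos[of "k + (1, 0)"] mom_pos[of "k + (0, 1)"]
  by (simp_all add: alpha_def beta_def W_def)

lemma moment_W: "moment W i j = mom (j, i)"
proof -
  have "mom k \<noteq> 0" for k using mom_pos[of k] by simp
  then have "moment W i j = mom (j, i) / mom (0, 0)"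
    unfolding moment_def
    by (subst path_product_telescope[of mom]) (simp_all add: weights count_list_replicate)
  also have "mom (0, 0) = 1" using mass_total by (simp add: mom_def summand_def)
  finally show ?thesis by simp
qed

lemma shift_weights_W: "shift_weights W"
proof -
  let ?X = "\<Sum>p\<in>P. fst p + snd p"
  have X: "fst p \<le> ?X" "snd p \<le> ?X" if "p \<in> P" for p
  proof -
    have "fst p + snd p \<le> ?X"
      using that finite_P nonneg by (intro member_le_sum) auto
    then show "fst p \<le> ?X" "snd p \<le> ?X" using nonneg[OF that] by linarith+
  qed
  have "mom (k + (1, 0)) \<le> ?X * mom k" "mom (k + (0, 1)) \<le> ?X * mom k" for k
    unfolding mom_def summand_step sum_distrib_left[of ?X]
    by (intro sum_mono mult_right_mono X summand_nonneg; assumption)+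
  then have "alpha W k \<le> sqrt ?X" "beta W k \<le> sqrt ?X" for k
    using mom_pos[of k] by (simp_all add: alpha_def beta_def W_def pos_divide_le_eq)
  then show ?thesis unfolding shift_weights_def using weights by blast
qed

text \<open>
  The squared norm of a shift bounds the squares of its weights, which are the quotients of
  successive moments. Along a coordinate axis this bounds the growth of the power sums of the
  corresponding coordinate of the atoms.
\<close>

lemma berger_measure_W: "berger_measure W (atomic_measure P \<rho>)"
proof -
  let ?N1 = "operator_norm (shift1 W)" and ?N2 = "operator_norm (shift2 W)"
  note le = weight_le_operator_norm[OF shift_weights_W]
  have N: "0 < ?N1" "0 < ?N2"
    using le[of "(0, 0)"] weights(1,2)[of "(0, 0)"] by linarith+
  have sq: "(alpha W k)\<^sup>2 \<le> ?N1\<^sup>2" "(beta W k)\<^sup>2 \<le> ?N2\<^sup>2" for k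
    by (rule power_mono[OF _ less_imp_le]; use le weights in blast)+
  have step: "mom (k + (1, 0)) \<le> ?N1\<^sup>2 * mom k" "mom (k + (0, 1)) \<le> ?N2\<^sup>2 * mom k" for k
    using sq[of k] mom_pos[of k] unfolding weights by (simp_all add: pos_divide_le_eq)
  have "fst p \<le> ?N1\<^sup>2" if "p \<in> P" for p
  proof (rule atom_le_growth[OF finite_P mass_pos _ _ _ that, where x = fst])
    show "(\<Sum>p\<in>P. \<rho> p * fst p ^ Suc n) \<le> ?N1\<^sup>2 * (\<Sum>p\<in>P. \<rho> p * fst p ^ n)" for n
      using step(1)[of "(n, 0)"] by (simp add: mom_def summand_def)
  qed (use nonneg N in auto)
  moreover have "snd p \<le> ?N2\<^sup>2" if "p \<in> P" for p
  proof (rule atom_le_growth[OF finite_P mass_pos _ _ _ that, where x = snd])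
    show "(\<Sum>p\<in>P. \<rho> p * snd p ^ Suc n) \<le> ?N2\<^sup>2 * (\<Sum>p\<in>P. \<rho> p * snd p ^ n)" for n
      using step(2)[of "(0, n)"] by (simp add: mom_def summand_def)
  qed (use nonneg N in auto)
  ultimately have "P \<subseteq> {0..?N1\<^sup>2} \<times> {0..?N2\<^sup>2}" using nonneg by force
  then have "supported_in (atomic_measure P \<rho>) ({0..?N1\<^sup>2} \<times> {0..?N2\<^sup>2})"
    by (intro supported_in_atomic_measure[OF finite_P]) (auto intro!: borel_closed closed_Times)
  moreover have "has_moment (atomic_measure P \<rho>) i j (moment W i j)" for i j
    using has_moment_atomic_measure[OF finite_P mass_pos, where i = i and j = j]
    by (simp add: moment_W mom_def summand_def eval_monom_def mult_ac)
  ultimately show ?thesis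
    using prob_space_atomic_measure[OF finite_P mass_pos mass_total]
    by (simp add: berger_measure_def)
qed

text \<open>
  The normal extension acts on functions of \<open>(s, a, b)\<close>, where \<open>s\<close> numbers the atoms and \<open>(a, b)\<close> runs
  through \<open>\<int>\<^sup>2\<close>. It moves \<open>(a, b)\<close> by one step and multiplies by the root of the corresponding
  coordinate of the atom. A zero coordinate causes no difficulty, since the operator then vanishes on that
  summand, and so does the image under \<open>V\<close> of every basis vector with positive exponent of that
  coordinate. The triples, with \<open>s\<close> allowed to be any natural number, are enumerated by \<open>\<tau>\<close>;
  the numbers that are not the number of an atom get weight zero.
\<close>

theorem subnormal_W: "subnormal_pair (shift1 W) (shift2 W)"
proof -
  obtain pt where pt: "bij_betw pt {0..<card P} P"
    using ex_bij_betw_nat_finite[OF finite_P] by blast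
  define S where "S = {0..<card P}"
  have ptP: "pt s \<in> P" if "s \<in> S" for s using pt that by (auto simp: S_def bij_betw_def)
  have "infinite (UNIV :: (nat \<times> int \<times> int) set)" by (simp add: finite_prod)
  then have "bij_betw (to_nat_on UNIV) (UNIV :: (nat \<times> int \<times> int) set) UNIV"
    by (intro to_nat_on_infinite) simp_all
  then obtain \<tau> :: "nat \<times> int \<times> int \<Rightarrow> nat" where \<tau>: "bij \<tau>" by blast
  have \<tau>_inj: "\<tau> x = \<tau> y \<longleftrightarrow> x = y" for x y
    using bij_is_inj[OF \<tau>] by (auto dest: injD)
  define \<phi> where "\<phi> = inv_into UNIV \<tau>"
  have \<phi>\<tau>: "\<phi> (\<tau> x) = x" for x using bij_is_inj[OF \<tau>] by (simp add: \<phi>_def)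
  have \<tau>\<phi>: "\<tau> (\<phi> n) = n" for n using bij_is_surj[OF \<tau>] by (simp add: \<phi>_def surj_f_inv_f)
  define \<pi> where "\<pi> d1 d2 n = (case \<phi> n of (s, a, b) \<Rightarrow> \<tau> (s, a - d1, b - d2))" for d1 d2 n
  have \<pi>: "\<pi> d1 d2 (\<tau> (s, a, b)) = \<tau> (s, a - d1, b - d2)" for d1 d2 s a b
    by (simp add: \<pi>_def \<phi>\<tau>)
  have ex: "\<exists>s a b. n = \<tau> (s, a, b)" for n using \<tau>\<phi>[of n] by (metis prod_cases3)
  have bij_\<pi>: "bij (\<pi> d1 d2)" for d1 d2
  proof (rule o_bij[of "\<pi> (- d1) (- d2)"])
    show "\<pi> (- d1) (- d2) \<circ> \<pi> d1 d2 = id" "\<pi> d1 d2 \<circ> \<pi> (- d1) (- d2) = id"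
      using ex by (auto simp: fun_eq_iff) (metis \<pi> add_diff_cancel diff_add_cancel diff_minus_eq_add)+
  qed
  define ev where "ev h n = (case \<phi> n of (s, a, b) \<Rightarrow>
    if s \<in> S then complex_of_real (sqrt (h (pt s))) else 0)" for h :: "real \<times> real \<Rightarrow> real" and n
  have ev: "ev h (\<tau> (s, a, b)) = (if s \<in> S then complex_of_real (sqrt (h (pt s))) else 0)" for h s a b
    by (simp add: ev_def \<phi>\<tau>)
  have ev_\<pi>: "ev h (\<pi> d1 d2 n) = ev h n" for h d1 d2 n
    using ex[of n] by (auto simp: \<pi> ev)
  have normal: "normal_operator (weighted_comp UNIV (ev h) (\<pi> d1 d2))" for h d1 d2
  proof (rule normal_weighted_permutation)
    show "bij (\<pi> d1 d2)" by (rule bij_\<pi>)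
    show "ev h (\<pi> d1 d2 n) = ev h n" for n by (rule ev_\<pi>)
    show "cmod (ev h n) \<le> (\<Sum>s\<in>S. \<bar>sqrt (h (pt s))\<bar>)" for n
      using ex[of n] by (auto simp: ev S_def intro!: sum_nonneg member_le_sum)
  qed
  define N1 where "N1 = weighted_comp UNIV (ev fst) (\<pi> 1 0)"
  define N2 where "N2 = weighted_comp UNIV (ev snd) (\<pi> 0 1)"
  have comm: "operators_commute N1 N2"
    unfolding operators_commute_def
  proof (intro ballI ext)
    fix f :: "nat \<Rightarrow> complex" and n
    obtain s a b where n: "n = \<tau> (s, a, b)" using ex by blast
    show "N1 (N2 f) n = N2 (N1 f) n"
      by (simp add: N1_def N2_def weighted_comp_def n \<pi> ev)
  qed
  define \<iota> where "\<iota> = (\<lambda>(k :: nat \<times> nat, s). \<tau> (s, int (fst k), int (snd k)))"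
  define c where "c n = (case \<phi> n of (s, a, b) \<Rightarrow>
    complex_of_real (sqrt (summand (pt s) (nat a, nat b) / mom (nat a, nat b))))" for n
  define V where "V = weighted_comp (\<iota> ` (UNIV \<times> S)) c (\<lambda>n. case \<phi> n of (s, a, b) \<Rightarrow> (nat a, nat b))"
  have isometry: "linear_isometry V"
    unfolding V_def
  proof (rule weighted_comp_isometry[OF _ _ refl])
    show "inj_on \<iota> (UNIV \<times> S)" by (auto simp: inj_on_def \<iota>_def \<tau>_inj)
    show "finite S" by (simp add: S_def)
    show "(case \<phi> (\<iota> (k, s)) of (s, a, b) \<Rightarrow> (nat a, nat b)) = k" for k s
      by (simp add: \<iota>_def \<phi>\<tau>)
    show "(\<Sum>s\<in>S. (cmod (c (\<iota> (k, s))))\<^sup>2) = 1" for k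
    proof -
      have "(\<Sum>s\<in>S. (cmod (c (\<iota> (k, s))))\<^sup>2) = (\<Sum>s\<in>S. summand (pt s) k / mom k)"
        using ptP summand_nonneg mom_pos[of k]
        by (intro sum.cong) (simp_all add: c_def \<iota>_def \<phi>\<tau> less_imp_le)
      also have "\<dots> = (\<Sum>p\<in>P. summand p k / mom k)"
        using sum.reindex_bij_betw[OF pt, of "\<lambda>p. summand p k / mom k"] by (simp add: S_def)
      also have "\<dots> = 1" using mom_pos[of k] by (simp add: mom_def flip: sum_divide_distrib)
      finally show ?thesis .
    qed
  qed
  have V: "V f (\<tau> (s, a, b)) = (if s \<in> S \<and> 0 \<le> a \<and> 0 \<le> b then
      complex_of_real (sqrt (summand (pt s) (nat a, nat b) / mom (nat a, nat b))) * f (nat a, nat b) else 0)"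
    for f s a b
  proof -
    have "\<tau> (s, a, b) \<in> \<iota> ` (UNIV \<times> S) \<longleftrightarrow> s \<in> S \<and> 0 \<le> a \<and> 0 \<le> b"
    proof
      assume "s \<in> S \<and> 0 \<le> a \<and> 0 \<le> b"
      then show "\<tau> (s, a, b) \<in> \<iota> ` (UNIV \<times> S)"
        by (intro image_eqI[of _ _ "((nat a, nat b), s)"]) (simp_all add: \<iota>_def)
    qed (auto simp: \<iota>_def \<tau>_inj)
    then show ?thesis by (simp add: V_def weighted_comp_def c_def \<phi>\<tau>)
  qed
  \<comment> \<open>The weight from \<open>k\<close> to \<open>k'\<close> compensates the change of normalization in \<open>V\<close>.\<close>
  have move: "sqrt x * sqrt (t / mom k) = sqrt (x * t / mom k') * sqrt (mom k' / mom k)" for x t k k'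
    using mom_pos[of k'] by (simp flip: real_sqrt_mult)
  have shift1_at: "shift1 \<Omega> f (k + (1, 0)) = of_real (alpha \<Omega> k) * f k" for \<Omega> f k
    by (cases k) (simp add: shift1_def)
  have shift2_at: "shift2 \<Omega> f (k + (0, 1)) = of_real (beta \<Omega> k) * f k" for \<Omega> f k
    by (cases k) (simp add: shift2_def)
  have "N1 (V f) = V (shift1 W f)" for f
  proof
    fix n
    obtain s a b where n: "n = \<tau> (s, a, b)" using ex by blast
    show "N1 (V f) n = V (shift1 W f) n"
    proof (cases "s \<in> S \<and> 0 < a \<and> 0 \<le> b")
      case True
      define k where "k = (nat (a - 1), nat b)"
      have k: "(nat a, nat b) = k + (1, 0)" using True by (auto simp: k_def)
      have "N1 (V f) n = complex_of_real (sqrt (fst (pt s)) * sqrt (summand (pt s) k / mom k)) * f k"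
        using True by (simp add: N1_def weighted_comp_def n \<pi> ev V k_def)
      also have "sqrt (fst (pt s)) * sqrt (summand (pt s) k / mom k) =
          sqrt (summand (pt s) (k + (1, 0)) / mom (k + (1, 0))) * alpha W k"
        using move[of "fst (pt s)" "summand (pt s) k" k "k + (1, 0)"]
        by (simp only: summand_step alpha_def W_def fst_conv)
      also have "complex_of_real \<dots> * f k = V (shift1 W f) n"
        using True by (simp add: n V k shift1_at del: One_nat_def)
      finally show ?thesis .
    qed (auto simp: N1_def weighted_comp_def n \<pi> ev V shift1_def)
  qed
  moreover have "N2 (V f) = V (shift2 W f)" for f
  proof
    fix n
    obtain s a b where n: "n = \<tau> (s, a, b)" using ex by blast
    show "N2 (V f) n = V (shift2 W f) n"
    proof (cases "s \<in> S \<and> 0 \<le> a \<and> 0 < b")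
      case True
      define k where "k = (nat a, nat (b - 1))"
      have k: "(nat a, nat b) = k + (0, 1)" using True by (auto simp: k_def)
      have "N2 (V f) n = complex_of_real (sqrt (snd (pt s)) * sqrt (summand (pt s) k / mom k)) * f k"
        using True by (simp add: N2_def weighted_comp_def n \<pi> ev V k_def)
      also have "sqrt (snd (pt s)) * sqrt (summand (pt s) k / mom k) =
          sqrt (summand (pt s) (k + (0, 1)) / mom (k + (0, 1))) * beta W k"
        using move[of "snd (pt s)" "summand (pt s) k" k "k + (0, 1)"]
        by (simp only: summand_step beta_def W_def snd_conv)
      also have "complex_of_real \<dots> * f k = V (shift2 W f) n"
        using True by (simp add: n V k shift2_at del: One_nat_def)
      finally show ?thesis .
    qed (auto simp: N2_def weighted_comp_def n \<pi> ev V shift2_def)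
  qed
  ultimately show ?thesis
    unfolding subnormal_pair_def
    using normal comm isometry unfolding N1_def N2_def by blast
qed

end

section \<open>The flat extension theorem for weight families\<close>

lemma path_product_cong:
  assumes "\<And>k. deg k \<le> m \<Longrightarrow> \<Omega> k = \<Omega>' k" "deg k + length s \<le> Suc m"
  shows "path_product \<Omega> k s = path_product \<Omega>' k s"
  using assms(2)
proof (induction s arbitrary: k)
  case (Cons a s)
  then show ?case using assms(1)[of k] by (cases a) (simp_all add: deg_add alpha_def beta_def deg_def)
qed simp

lemma shifted_moment_mat_cong:
  assumes "\<And>k. deg k \<le> m \<Longrightarrow> \<Omega> k = \<Omega>' k" "2 * l + deg w \<le> Suc m"
  shows "shifted_moment_mat l w \<Omega> = shifted_moment_mat l w \<Omega>'"
proof -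
  have "moment_fun \<Omega> (u + v + w) = moment_fun \<Omega>' (u + v + w)" if "deg u \<le> l" "deg v \<le> l" for u v
    unfolding moment_fun_def moment_def
    by (rule path_product_cong[OF assms(1)]) (use that assms(2) in \<open>auto simp: deg_def\<close>)
  moreover have "deg (multi_indices l ! r) \<le> l" if "r < length (multi_indices l)" for r
    using nth_mem[OF that] by (simp add: set_multi_indices)
  ultimately show ?thesis unfolding shifted_moment_mat_alt by (intro eq_matI) auto
qed

text \<open>
  The rows of degree at most \<open>l = m div 2 + 1\<close> involve only moments that the extended family shares with the
  intermediate family, so both matrices in the flatness condition belong to one moment sequence.
\<close>

theorem theorem4p3:
  fixes m mt :: nat and \<Omega> \<Omega>t \<Omega>h :: weight_family
  assumes "commutative_family m \<Omega>"
    and "mt = 2 * (m div 2) + 1"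
    and "commutative_family mt \<Omega>t" and "is_extension mt \<Omega>t m \<Omega>"
    and "pos_semidef (M_mat mt \<Omega>t)"
    and "commutative_family (mt + 2) \<Omega>h" and "is_extension (mt + 2) \<Omega>h mt \<Omega>t"
    and "mat_rank (M_mat (mt + 2) \<Omega>h) = mat_rank (M_mat mt \<Omega>t)"
    and "pos_semidef (Mx_mat (mt + 2) \<Omega>h)"
    and "pos_semidef (My_mat (mt + 2) \<Omega>h)"
  shows "\<exists>\<mu> :: (real \<times> real) measure.
    representing_measure (mt + 2) \<Omega>h \<mu> \<and>
    supported_in \<mu> ({0..} \<times> {0..}) \<and>
    supported_in \<mu> (atoms \<mu>) \<and>
    finite (atoms \<mu>) \<and> card (atoms \<mu>) = mat_rank (M_mat mt \<Omega>t) \<and>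
    int (card (atoms \<mu> \<inter> {0} \<times> {0..})) =
      int (mat_rank (M_mat mt \<Omega>t)) - int (mat_rank (Mx_mat (mt + 2) \<Omega>h)) \<and>
    int (card (atoms \<mu> \<inter> {0..} \<times> {0})) =
      int (mat_rank (M_mat mt \<Omega>t)) - int (mat_rank (My_mat (mt + 2) \<Omega>h)) \<and>
    (atoms \<mu> \<inter> {0<..} \<times> {0<..} \<noteq> {} \<longrightarrow>
      (\<exists>W. subnormal_completion m \<Omega> W \<and> berger_measure W \<mu>))"
proof -
  define l where "l = m div 2 + 1"
  define \<gamma> where "\<gamma> = moment_fun \<Omega>h"
  have l: "(mt + 1) div 2 = l" "(mt + 2 + 1) div 2 = Suc l" "mt = 2 * l - 1" "1 \<le> l" "m \<le> mt"
    using assms(2) by (auto simp: l_def)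
  have agree_t: "\<Omega>h k = \<Omega>t k" if "deg k \<le> mt" for k
    using assms(7) that unfolding is_extension_def by blast
  have agree: "\<Omega>h k = \<Omega> k" if "deg k \<le> m" for k
    using assms(4) agree_t[of k] l(5) that unfolding is_extension_def by (metis le_trans)
  have Mt: "M_mat mt \<Omega>t = shifted_moment_mat l (0, 0) \<Omega>h"
    unfolding M_mat_def l(1)
    by (rule shifted_moment_mat_cong[of mt]) (use agree_t l in \<open>auto simp: deg_def\<close>)
  have zero: "u + (0, 0) = u" for u :: "nat \<times> nat" by (cases u) simp
  have rank_t: "mat_rank (M_mat mt \<Omega>t) = dim (moment_column \<gamma> l ` {u. deg u \<le> l})"
    unfolding Mt mat_rank_shifted_moment_mat by (simp add: zero \<gamma>_def)
  have rank_h: "mat_rank (M_mat (mt + 2) \<Omega>h) = dim (moment_column \<gamma> (Suc l) ` {u. deg u \<le> Suc l})"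
    unfolding M_mat_def l(2) mat_rank_shifted_moment_mat by (simp add: zero \<gamma>_def)
  have Mx: "Mx_mat (mt + 2) \<Omega>h = shifted_moment_mat l (0, 1) \<Omega>h"
    and My: "My_mat (mt + 2) \<Omega>h = shifted_moment_mat l (1, 0) \<Omega>h"
    unfolding Mx_mat_def My_mat_def l(2) by simp_all
  have psd: "0 \<le> (\<Sum>u | deg u \<le> l. \<Sum>v | deg v \<le> l. c u * c v * \<gamma> (u + v))" for c
    using pos_semidef_shifted_moment_mat[OF assms(5)[unfolded Mt], of c] by (simp add: zero \<gamma>_def)
  have psd_x: "0 \<le> (\<Sum>u | deg u \<le> l. \<Sum>v | deg v \<le> l. c u * c v * \<gamma> (u + v + (0, 1)))" for c
    unfolding \<gamma>_def by (rule pos_semidef_shifted_moment_mat[OF assms(9)[unfolded Mx]])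
  have psd_y: "0 \<le> (\<Sum>u | deg u \<le> l. \<Sum>v | deg v \<le> l. c u * c v * \<gamma> (u + v + (1, 0)))" for c
    unfolding \<gamma>_def by (rule pos_semidef_shifted_moment_mat[OF assms(10)[unfolded My]])
  obtain P \<rho> where P: "finite P" "card P = dim (moment_column \<gamma> l ` {u. deg u \<le> l})"
    and \<rho>: "\<And>p. p \<in> P \<Longrightarrow> 0 < \<rho> p" and quadrant: "P \<subseteq> {0..} \<times> {0..}"
    and rep: "\<And>u. deg u \<le> 2 * l + 2 \<Longrightarrow> \<gamma> u = (\<Sum>p\<in>P. \<rho> p * eval_monom p u)"
    and dim_x: "dim (moment_column (\<lambda>u. \<gamma> (u + (0, 1))) l ` {u. deg u \<le> l}) = card {p \<in> P. fst p \<noteq> 0}"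
    and dim_y: "dim (moment_column (\<lambda>u. \<gamma> (u + (1, 0))) l ` {u. deg u \<le> l}) = card {p \<in> P. snd p \<noteq> 0}"
    using flat_moments_atomic[OF psd psd_x psd_y assms(8)[unfolded rank_h rank_t]] by blast
  have cardP: "card P = mat_rank (M_mat mt \<Omega>t)" using P(2) rank_t by simp
  have rank_x: "mat_rank (Mx_mat (mt + 2) \<Omega>h) = card {p \<in> P. fst p \<noteq> 0}"
    and rank_y: "mat_rank (My_mat (mt + 2) \<Omega>h) = card {p \<in> P. snd p \<noteq> 0}"
    unfolding Mx My mat_rank_shifted_moment_mat using dim_x dim_y by (simp_all only: \<gamma>_def)
  let ?\<mu> = "atomic_measure P \<rho>"
  have atoms: "atoms ?\<mu> = P" by (rule atoms_atomic_measure[OF P(1) \<rho>])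
  have moments: "moment \<Omega>h i j = (\<Sum>p\<in>P. \<rho> p * eval_monom p (i, j))" if "i + j \<le> mt + 2 + 1" for i j
    using rep[of "(i, j)"] that l by (simp add: \<gamma>_def moment_fun_def deg_def)
  have representing: "representing_measure (mt + 2) \<Omega>h ?\<mu>"
    using has_moment_atomic_measure[OF P(1) \<rho>] moments
    unfolding representing_measure_def by simp
  have split_card: "int (card (P \<inter> {p. h p = 0})) = int (card P) - int (card {p \<in> P. h p \<noteq> 0})"
    for h :: "real \<times> real \<Rightarrow> real"
  proof -
    have "card P = card (P \<inter> {p. h p = 0}) + card {p \<in> P. h p \<noteq> 0}"
      using P(1) by (subst card_Un_disjoint[symmetric]) (auto intro: arg_cong[of _ _ card])
    then show ?thesis by simp
  qed
  have axes: "P \<inter> {0} \<times> {0..} = P \<inter> {p. fst p = 0}" "P \<inter> {0..} \<times> {0} = P \<inter> {p. snd p = 0}"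
    using quadrant by auto
  have completion: "\<exists>W. subnormal_completion m \<Omega> W \<and> berger_measure W ?\<mu>"
    if interior: "P \<inter> {0<..} \<times> {0<..} \<noteq> {}"
  proof -
    have "(\<Sum>p\<in>P. \<rho> p) = 1"
      using moments[of 0 0] by (simp add: moment_def eval_monom_def)
    moreover obtain p where "p \<in> P" "0 < fst p" "0 < snd p" using interior by auto
    ultimately interpret quadrant_atoms P \<rho>
      using P(1) \<rho> quadrant by unfold_locales auto
    \<comment> \<open>Lattice points carry the exponent of \<open>x\<close> first, moments the exponent of \<open>y\<close>.\<close>
    have mom: "moment \<Omega>h (snd k) (fst k) = mom k" if "deg k \<le> mt + 2 + 1" for k
      using moments[of "snd k" "fst k"] that
      by (simp add: mom_def summand_def eval_monom_def deg_def mult_ac add.commute)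
    have "W k = \<Omega> k" if k: "deg k \<le> m" for k
    proof -
      have dk: "deg k \<le> mt + 2" using k l(5) by simp
      have pos: "0 < alpha \<Omega>h k" "0 < beta \<Omega>h k"
        using assms(6) dk unfolding commutative_family_def positive_family_def by blast+
      have "mom (k + (1, 0)) = mom k * (alpha \<Omega>h k)\<^sup>2"
        using moment_step_x[OF assms(6) dk] mom[of k] mom[of "k + (1, 0)"] dk
        by (simp add: deg_def)
      then have "alpha W k = alpha \<Omega>h k"
        using mom_pos[of k] pos by (simp add: alpha_def[of W] W_def)
      moreover have "mom (k + (0, 1)) = mom k * (beta \<Omega>h k)\<^sup>2"
        using moment_step_y[of \<Omega>h k] mom[of k] mom[of "k + (0, 1)"] dk
        by (simp add: deg_def)
      then have "beta W k = beta \<Omega>h k"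
        using mom_pos[of k] pos by (simp add: beta_def[of W] W_def)
      ultimately show ?thesis using agree[OF k] by (simp add: alpha_def beta_def prod_eq_iff)
    qed
    then show ?thesis
      using shift_weights_W subnormal_W berger_measure_W unfolding subnormal_completion_def by blast
  qed
  show ?thesis
  proof (intro exI[of _ ?\<mu>] conjI)
    show "supported_in ?\<mu> ({0..} \<times> {0..})"
      by (rule supported_in_atomic_measure[OF P(1) quadrant]) (auto intro!: borel_closed closed_Times)
    show "supported_in ?\<mu> (atoms ?\<mu>)"
      unfolding atoms using P(1)
      by (intro supported_in_atomic_measure) (auto intro: borel_closed finite_imp_closed)
  qed (use representing P(1) cardP completion split_card[of fst] split_card[of snd] rank_x rank_y
        in \<open>simp_all add: atoms axes\<close>)
qed

end
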